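(* Let $(\Omega,\mu,W)$ and $(\Omega',\mu',W')$ be two pure graphons. If they are equivalent, then their covering numbers are equal: $N^{(c)}_\Omega(\epsilon)=N^{(c)}_{\Omega'}(\epsilon)$ for all $\epsilon>0$.
   Context: A graphon is a triplet $(\Omega,\mu,W)$ where $\Omega$ is a measurable space, $\mu$ a probability measure on $\Omega$ and $W:\Omega\times\Omega\to[0,1]$ a symmetric measurable function. Neighborhood distance: $r_W(\omega,\omega')=\big(\int_\Omega |W(\omega,z)-W(\omega',z)|^2\mu(dz)\big)^{1/2}$. A graphon is pure if $(\Omega,r_W)$ is a complete separable metric space and $\mu$ has full support (every ball of non-zero radius has positive $\mu$-measure). $W$-random graph model: for each $n$, $\omega_1,\dots,\omega_n$ are i.i.d. with law $\mu$ and, conditionally on them, $A_{ij}$, $i<j$, are independent Bernoulli with parameters $W(\omega_i,\omega_j)$, $A_{ji}=A_{ij}$, $A_{ii}=0$. Two graphons are equivalent if they induce the same distribution of the adjacency matrix $A\in\{0,1\}^{n\times n}$ for every $n$. It is known (Lovász) that this holds if and only if there are measure-preserving maps $\phi:[0,1]\to\Omega$ and $\psi:[0,1]\to\Omega'$ ($[0,1]$ with the uniform measure) with $W(\phi(x),\phi(y))=W'(\psi(x),\psi(y))$ for almost every $(x,y)$. $N^{(c)}_\Omega(\epsilon)$ is the minimal number of closed $r_W$-balls of radius $\epsilon$ with centers in $\Omega$ needed to cover $\Omega$ (possibly $+\infty$); $N^{(c)}_{\Omega'}(\epsilon)$ is defined likewise with $r_{W'}$. *)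

theory Defs
  imports "HOL-Probability.Probability"
begin

locale graphon = prob_space M
  for M :: "'a measure" and W :: "'a \<Rightarrow> 'a \<Rightarrow> real" +
  assumes W_measurable [measurable]: "case_prod W \<in> borel_measurable (M \<Otimes>\<^sub>M M)"
    and W_range: "x \<in> space M \<Longrightarrow> y \<in> space M \<Longrightarrow> W x y \<in> {0..1}"
    and W_sym: "x \<in> space M \<Longrightarrow> y \<in> space M \<Longrightarrow> W x y = W y x"

definition nbhd_dist :: "'a measure \<Rightarrow> ('a \<Rightarrow> 'a \<Rightarrow> real) \<Rightarrow> 'a \<Rightarrow> 'a \<Rightarrow> real" where
  "nbhd_dist M W x y = sqrt (LINT z|M. \<bar>W x z - W y z\<bar>\<^sup>2)"

text \<open>
  That \<^const>\<open>nbhd_dist\<close> is a metric, and not merely a pseudometric, on \<open>space M\<close> is part of purity.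
\<close>

locale pure_graphon = graphon M W + Metric_space "space M" "nbhd_dist M W"
  for M :: "'a measure" and W :: "'a \<Rightarrow> 'a \<Rightarrow> real" +
  assumes complete: "mcomplete"
    and separable: "separable_space mtopology"
    and full_support: "x \<in> space M \<Longrightarrow> r > 0 \<Longrightarrow> emeasure M (mball x r) > 0"

text \<open>
  The conditional law of the adjacency matrix given the latent positions \<open>\<omega> 0, \<dots>, \<omega> (n - 1)\<close>.
  Zero-one matrices of size \<open>n\<close> are represented as functions that vanish outside
  \<open>{..<n} \<times> {..<n}\<close>. The entries \<open>X (i, j)\<close> with \<open>i < j < n\<close> are independent Bernoulli variables, and
  \<open>X\<close> is \<open>False\<close> everywhere else, so the diagonal of the matrix vanishes.
\<close>

definition adjacency_pmf ::
  "('a \<Rightarrow> 'a \<Rightarrow> real) \<Rightarrow> nat \<Rightarrow> (nat \<Rightarrow> 'a) \<Rightarrow> (nat \<Rightarrow> nat \<Rightarrow> nat) pmf" where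
  "adjacency_pmf W n \<omega> =
     map_pmf (\<lambda>X i j. of_bool (X (min i j, max i j)))
       (Pi_pmf {(i, j). i < j \<and> j < n} False (\<lambda>(i, j). bernoulli_pmf (W (\<omega> i) (\<omega> j))))"

definition random_graph ::
  "'a measure \<Rightarrow> ('a \<Rightarrow> 'a \<Rightarrow> real) \<Rightarrow> nat \<Rightarrow> (nat \<Rightarrow> nat \<Rightarrow> nat) measure" where
  "random_graph M W n =
     (PiM {..<n} (\<lambda>_. M)) \<bind> (\<lambda>\<omega>. measure_pmf (adjacency_pmf W n \<omega>))"

definition graphon_equiv ::
  "'a measure \<Rightarrow> ('a \<Rightarrow> 'a \<Rightarrow> real) \<Rightarrow> 'b measure \<Rightarrow> ('b \<Rightarrow> 'b \<Rightarrow> real) \<Rightarrow> bool" where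
  "graphon_equiv M W M' W' \<longleftrightarrow> (\<forall>n. random_graph M W n = random_graph M' W' n)"

text \<open>
  The kernel in \<^const>\<open>random_graph\<close> is measurable, so the monadic bind really is the mixture.
\<close>

lemma (in graphon) measurable_adjacency_pmf:
  "(\<lambda>\<omega>. measure_pmf (adjacency_pmf W n \<omega>))
     \<in> PiM {..<n} (\<lambda>_. M) \<rightarrow>\<^sub>M subprob_algebra (count_space UNIV)"
proof -
  let ?E = "{(i, j). i < j \<and> j < n}"
  let ?P = "PiM {..<n} (\<lambda>_. M)"
  let ?q = "\<lambda>\<omega>. \<lambda>(i, j). bernoulli_pmf (W (\<omega> i) (\<omega> j))"
  define S where "S = PiE_dflt ?E False (\<lambda>_. UNIV :: bool set)"
  have fin: "finite ?E"
    by (rule finite_subset[of _ "{..<n} \<times> {..<n}"]) auto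
  have finS: "finite S"
    unfolding S_def using fin by (intro finite_PiE_dflt) auto
  have kern: "(\<lambda>\<omega>. measure_pmf (Pi_pmf ?E False (?q \<omega>))) \<in> ?P \<rightarrow>\<^sub>M subprob_algebra (count_space UNIV)"
  proof (rule measurable_subprob_algebra)
    fix A :: "(nat \<times> nat \<Rightarrow> bool) set"
    have eq: "emeasure (measure_pmf (Pi_pmf ?E False (?q \<omega>))) A =
        ennreal (\<Sum>f\<in>A \<inter> S. \<Prod>e\<in>?E. pmf (?q \<omega> e) (f e))" for \<omega>
    proof -
      have "set_pmf (Pi_pmf ?E False (?q \<omega>)) \<subseteq> S"
        using fin by (auto simp: S_def set_Pi_pmf PiE_dflt_def)
      hence "measure_pmf.prob (Pi_pmf ?E False (?q \<omega>)) A
          = measure_pmf.prob (Pi_pmf ?E False (?q \<omega>)) (A \<inter> S)"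
        by (intro measure_pmf.finite_measure_eq_AE) (auto simp: AE_measure_pmf_iff)
      also have "\<dots> = (\<Sum>f\<in>A \<inter> S. pmf (Pi_pmf ?E False (?q \<omega>)) f)"
        using finS by (simp add: measure_measure_pmf_finite)
      also have "\<dots> = (\<Sum>f\<in>A \<inter> S. \<Prod>e\<in>?E. pmf (?q \<omega> e) (f e))"
        using fin by (intro sum.cong refl pmf_Pi') (auto simp: S_def PiE_dflt_def)
      finally show ?thesis
        by (simp add: measure_pmf.emeasure_eq_measure)
    qed
    have bern: "(\<lambda>\<omega>. pmf (?q \<omega> e) b) \<in> borel_measurable ?P" if e: "e \<in> ?E" for e b
    proof -
      obtain i j where ij: "e = (i, j)" "i < n" "j < n"
        using e by auto
      have *: "(\<lambda>\<omega>. W (\<omega> i) (\<omega> j)) \<in> borel_measurable ?P"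
        using measurable_compose[OF measurable_Pair[OF
            measurable_component_singleton[of i "{..<n}" "\<lambda>_. M"]
            measurable_component_singleton[of j "{..<n}" "\<lambda>_. M"]] W_measurable] ij
        by simp
      have "(\<lambda>\<omega>. if b then W (\<omega> i) (\<omega> j) else 1 - W (\<omega> i) (\<omega> j)) \<in> borel_measurable ?P"
        using * by (cases b) auto
      moreover have "pmf (?q \<omega> e) b = (if b then W (\<omega> i) (\<omega> j) else 1 - W (\<omega> i) (\<omega> j))"
        if "\<omega> \<in> space ?P" for \<omega>
        using W_range[of "\<omega> i" "\<omega> j"] that ij by (cases b) (auto simp: space_PiM PiE_iff)
      ultimately show ?thesis
        by (subst measurable_cong) auto
    qed
    show "(\<lambda>\<omega>. emeasure (measure_pmf (Pi_pmf ?E False (?q \<omega>))) A) \<in> borel_measurable ?P"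
      unfolding eq by (intro measurable_compose[OF _ measurable_ennreal]
          borel_measurable_sum borel_measurable_prod bern)
  qed (auto intro: subprob_space_measure_pmf)
  show ?thesis
    unfolding adjacency_pmf_def map_pmf_rep_eq
    by (rule measurable_compose[OF kern measurable_distr]) simp
qed

text \<open>The value is \<open>\<infinity>\<close> if there is no finite cover, since the infimum of the empty set is \<open>\<infinity>\<close>.\<close>

definition covering_number :: "'a measure \<Rightarrow> ('a \<Rightarrow> 'a \<Rightarrow> real) \<Rightarrow> real \<Rightarrow> enat" where
  "covering_number M W \<epsilon> =
     Inf {enat (card C) | C. finite C \<and> C \<subseteq> space M \<and>
       space M \<subseteq> (\<Union>c\<in>C. Metric_space.mcball (space M) (nbhd_dist M W) c \<epsilon>)}"

end

(* The codegree c(x, y) = \<integral> W(x, z) W(y, z) dz determines the neighbourhood distance, as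
   r(x, y)^2 = c(x, x) + c(y, y) - 2 c(x, y). For sampled positions \<omega> i, \<omega> j with i \<noteq> j, c(\<omega> i, \<omega> j) is the
   limiting density of common neighbours of i and j in the random graph. Since the two graphons are complete and separable,
   their infinite samples lie with probability at least 2/3 in compact sets K, K' of sequences that visit every ball
   infinitely often. For large n the random graphs generated from K and from K' each have probability
   more than 1/2 under the common law, so one graph is compatible with both, and by compactness there are
   \<omega> in K, \<omega>' in K' with c(\<omega> i, \<omega> j) = c'(\<omega>' i, \<omega>' j) for all i \<noteq> j. Recurrence extends this to i = j, so
   \<omega> and \<omega>' are isometric dense sequences; the spaces being complete, they are isometric. *)

theory Submission
  imports Defs
begin

section \<open>Codegrees\<close>

definition codegree :: "'a measure \<Rightarrow> ('a \<Rightarrow> 'a \<Rightarrow> real) \<Rightarrow> 'a \<Rightarrow> 'a \<Rightarrow> real" where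
  "codegree M W x y = (LINT z|M. W x z * W y z)"

context graphon
begin

lemma section_measurable: "x \<in> space M \<Longrightarrow> W x \<in> borel_measurable M"
  using measurable_compose[OF measurable_Pair1' W_measurable, of x] by simp

lemma integrable_section_mult:
  assumes "x \<in> space M" "y \<in> space M"
  shows "integrable M (\<lambda>z. W x z * W y z)"
proof (rule integrable_const_bound[where B = 1])
  show "AE z in M. norm (W x z * W y z) \<le> 1"
    using W_range assms by (intro AE_I2) (auto simp: abs_mult intro!: mult_le_one)
  show "(\<lambda>z. W x z * W y z) \<in> borel_measurable M"
    using assms by (intro borel_measurable_times section_measurable)
qed

lemma codegree_commute: "codegree M W x y = codegree M W y x"
  by (simp add: codegree_def mult.commute)

lemma codegree_range:
  assumes "x \<in> space M" "y \<in> space M"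
  shows "codegree M W x y \<in> {0..1}"
proof -
  have "codegree M W x y \<ge> 0"
    unfolding codegree_def using assms W_range by (intro integral_nonneg_AE AE_I2) simp
  moreover have "codegree M W x y \<le> 1"
    unfolding codegree_def using assms W_range 
    by (intro integral_le_const integrable_section_mult AE_I2) (auto intro!: mult_le_one)
  ultimately show ?thesis by simp
qed

lemma nbhd_dist_codegree:
  assumes "x \<in> space M" "y \<in> space M"
  shows "nbhd_dist M W x y = sqrt (codegree M W x x + codegree M W y y - 2 * codegree M W x y)"
proof -
  have "(LINT z|M. \<bar>W x z - W y z\<bar>\<^sup>2)
      = (LINT z|M. W x z * W x z + W y z * W y z - 2 * (W x z * W y z))"
    by (simp add: power2_eq_square algebra_simps)
  then show ?thesis
    using assms by (simp add: nbhd_dist_def codegree_def integrable_section_mult)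
qed

text \<open>As \<open>W y\<close> takes values in [0, 1], the difference is at most the L1 distance
  of the sections \<open>W x\<close> and \<open>W x'\<close>, which on a probability space is at
  most their L2 distance. With \<open>codegree_commute\<close> this gives continuity in both
  arguments.\<close>

lemma codegree_diff_le:
  assumes "x \<in> space M" "x' \<in> space M" "y \<in> space M"
  shows "\<bar>codegree M W x y - codegree M W x' y\<bar> \<le> nbhd_dist M W x x'"
proof -
  have meas: "(\<lambda>z. W x z - W x' z) \<in> borel_measurable M"
    using assms by (intro borel_measurable_diff section_measurable)
  have bd: "\<bar>W x z - W x' z\<bar> \<le> 1" if "z \<in> space M" for z
    using W_range[OF assms(1) that] W_range[OF assms(2) that] by auto
  have int1: "integrable M (\<lambda>z. \<bar>W x z - W x' z\<bar>)"
    using meas bd by (intro integrable_const_bound[where B = 1] AE_I2) auto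
  have int2: "integrable M (\<lambda>z. \<bar>W x z - W x' z\<bar>\<^sup>2)"
    using meas bd by (intro integrable_const_bound[where B = 1] AE_I2) (auto simp: abs_square_le_1)
  have "codegree M W x y - codegree M W x' y = (LINT z|M. (W x z - W x' z) * W y z)"
    using assms by (simp add: codegree_def integrable_section_mult left_diff_distrib)
  also have "\<bar>\<dots>\<bar> \<le> (LINT z|M. \<bar>(W x z - W x' z) * W y z\<bar>)"
    by (rule integral_abs_bound)
  also have "\<dots> \<le> (LINT z|M. \<bar>W x z - W x' z\<bar>)"
  proof (rule integral_mono_AE[OF _ int1])
    show "integrable M (\<lambda>z. \<bar>(W x z - W x' z) * W y z\<bar>)"
      using assms integrable_section_mult[of x y] integrable_section_mult[of x' y]
      by (simp add: left_diff_distrib)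
    show "AE z in M. \<bar>(W x z - W x' z) * W y z\<bar> \<le> \<bar>W x z - W x' z\<bar>"
      using W_range[OF assms(3)] by (intro AE_I2) (auto simp: abs_mult intro!: mult_left_le)
  qed
  also have "\<dots> \<le> nbhd_dist M W x x'"
  proof -
    \<comment> \<open>Jensen's inequality for the square, obtained as nonnegativity of a
      variance.\<close>
    have "(LINT z|M. \<bar>W x z - W x' z\<bar>)\<^sup>2 \<le> (LINT z|M. \<bar>W x z - W x' z\<bar>\<^sup>2)"
      using variance_positive[of "\<lambda>z. \<bar>W x z - W x' z\<bar>"] variance_eq[OF int1 int2] by simp
    then show ?thesis
      unfolding nbhd_dist_def by (rule real_le_rsqrt)
  qed
  finally show ?thesis .
qed

text \<open>The definition of a pure graphon does not say outright that metric balls are events.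
  Fubini's theorem, applied to the integral that defines the distance, provides this for closed
  balls.\<close>

lemma nbhd_dist_measurable:
  assumes "x \<in> space M"
  shows "nbhd_dist M W x \<in> borel_measurable M"
proof -
  have "(\<lambda>(y, z). \<bar>W x z - W y z\<bar>\<^sup>2) \<in> borel_measurable (M \<Otimes>\<^sub>M M)"
    using measurable_compose[OF measurable_snd section_measurable[OF assms], of M] W_measurable
    by (simp add: case_prod_unfold)
  then have "(\<lambda>y. LINT z|M. \<bar>W x z - W y z\<bar>\<^sup>2) \<in> borel_measurable M"
    by (rule borel_measurable_lebesgue_integral)
  then show ?thesis
    unfolding nbhd_dist_def by measurable
qed

text \<open>Joint measurability, again by Fubini, lets codegrees of sampled positions be integrated
  over the sample.\<close>

lemma codegree_measurable: "(\<lambda>(x, y). codegree M W x y) \<in> borel_measurable (M \<Otimes>\<^sub>M M)"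
proof -
  have "(\<lambda>(p, z). W (fst p) z * W (snd p) z) \<in> borel_measurable ((M \<Otimes>\<^sub>M M) \<Otimes>\<^sub>M M)"
  proof -
    have "(\<lambda>q. W (fst (fst q)) (snd q)) \<in> borel_measurable ((M \<Otimes>\<^sub>M M) \<Otimes>\<^sub>M M)"
         "(\<lambda>q. W (snd (fst q)) (snd q)) \<in> borel_measurable ((M \<Otimes>\<^sub>M M) \<Otimes>\<^sub>M M)"
      using measurable_compose[of "\<lambda>q. (fst (fst q), snd q)", OF _ W_measurable, of "(M \<Otimes>\<^sub>M M) \<Otimes>\<^sub>M M"]
       measurable_compose[of "\<lambda>q. (snd (fst q), snd q)", OF _ W_measurable, of "(M \<Otimes>\<^sub>M M) \<Otimes>\<^sub>M M"]
      by simp_all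
    then show ?thesis by (simp add: case_prod_unfold)
  qed
  then show ?thesis
    unfolding codegree_def case_prod_unfold
    by (intro borel_measurable_lebesgue_integral) (simp add: case_prod_unfold)
qed

end

section \<open>Metric spaces with isometric dense sequences\<close>

text \<open>Extends the correspondence of \<open>f i\<close> with \<open>g i\<close> beyond the
  sequences. Some \<open>f (k n)\<close> tend to \<open>x\<close>; the \<open>g (k n)\<close> have
  the same mutual distances, so they are Cauchy and converge in the complete space \<open>B\<close>.
  Their limit serves as \<open>y\<close>, since distances to each \<open>g j\<close> pass to the
  limit.\<close>

lemma Metric_space_transfer_point:
  assumes A: "Metric_space A d" and B: "Metric_space B e" "Metric_space.mcomplete B e"
    and f: "\<And>i::nat. f i \<in> A" and g: "\<And>i. g i \<in> B"
    and iso: "\<And>i j. e (g i) (g j) = d (f i) (f j)"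
    and dense: "\<And>\<epsilon>. \<epsilon> > 0 \<Longrightarrow> \<exists>i. d x (f i) < \<epsilon>"
    and x: "x \<in> A"
  shows "\<exists>y\<in>B. \<forall>j. e y (g j) = d x (f j)"
proof -
  interpret A: Metric_space A d by (rule A)
  interpret B: Metric_space B e by (rule B(1))
  have "\<exists>k. \<forall>n. d x (f (k n)) < 1 / Suc n"
    using dense by (intro choice) auto
  then obtain k where k: "\<And>n. d x (f (k n)) < 1 / Suc n"
    by blast
  have small: "eventually (\<lambda>n. d x (f (k n)) < \<epsilon>) sequentially" if "\<epsilon> > 0" for \<epsilon>
    using order_tendstoD(2)[OF LIMSEQ_Suc[OF lim_1_over_n] that]
    by eventually_elim (rule order_less_trans[OF k])
  have "B.MCauchy (\<lambda>n. g (k n))"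
    unfolding B.MCauchy_def
  proof (intro conjI allI impI)
    fix \<epsilon> :: real assume "\<epsilon> > 0"
    then obtain N where N: "\<And>n. n \<ge> N \<Longrightarrow> d x (f (k n)) < \<epsilon> / 2"
      using small[of "\<epsilon> / 2"] by (auto simp: eventually_sequentially)
    have "e (g (k n)) (g (k n')) < \<epsilon>" if "n \<ge> N" "n' \<ge> N" for n n'
      using A.triangle[OF f[of "k n"] x f[of "k n'"]] A.commute[of x "f (k n)"] N[OF that(1)] N[OF that(2)]
      unfolding iso by linarith
    then show "\<exists>N. \<forall>n n'. N \<le> n \<longrightarrow> N \<le> n' \<longrightarrow> e (g (k n)) (g (k n')) < \<epsilon>"
      by blast
  qed (use g in auto)
  then obtain y where y: "limitin B.mtopology (\<lambda>n. g (k n)) y sequentially"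
    using B(2) unfolding B.mcomplete_def by blast
  then have yB: "y \<in> B"
    by (simp add: B.limitin_metric)
  have "e y (g j) = d x (f j)" for j
  proof -
    have "\<bar>e y (g j) - d x (f j)\<bar> \<le> \<epsilon>" if "\<epsilon> > 0" for \<epsilon>
    proof -
      have "eventually (\<lambda>n. e (g (k n)) y < \<epsilon> / 2) sequentially"
        using conjunct2[OF y[unfolded B.limitin_metric], rule_format, OF half_gt_zero[OF that]]
        by (rule eventually_mono) simp
      moreover have "eventually (\<lambda>n. d x (f (k n)) < \<epsilon> / 2) sequentially"
        using small[OF half_gt_zero[OF that]] .
      ultimately have "eventually (\<lambda>n. e (g (k n)) y < \<epsilon> / 2 \<and> d x (f (k n)) < \<epsilon> / 2) sequentially"
        by eventually_elim simp
      then obtain n where n: "e (g (k n)) y < \<epsilon> / 2" "d x (f (k n)) < \<epsilon> / 2"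
        using eventually_happens'[OF sequentially_bot] by blast
      show ?thesis
        using n iso[of "k n" j] A.triangle[OF x f[of "k n"] f[of j]] A.triangle[OF f[of "k n"] x f[of j]]
          B.triangle[OF yB g[of "k n"] g[of j]] B.triangle[OF g[of "k n"] yB g[of j]]
          A.commute[of x "f (k n)"] B.commute[of y "g (k n)"]
        by linarith
    qed
    then have "\<bar>e y (g j) - d x (f j)\<bar> \<le> 0"
      by (rule field_le_epsilon[of _ 0, simplified])
    then show ?thesis by simp
  qed
  with yB show ?thesis by blast
qed

text \<open>Centres are carried over by \<open>Metric_space_transfer_point\<close>, and each point
  to be covered is carried back, so no global isometry has to be built. Comparing cardinalities by
  \<le> avoids proving the transfer injective.\<close>

lemma Metric_space_transfer_cover:
  assumes A: "Metric_space A d" "Metric_space.mcomplete A d"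
    and B: "Metric_space B e" "Metric_space.mcomplete B e"
    and f: "\<And>i::nat. f i \<in> A" and g: "\<And>i. g i \<in> B"
    and iso: "\<And>i j. e (g i) (g j) = d (f i) (f j)"
    and dense_f: "\<And>x \<epsilon>. x \<in> A \<Longrightarrow> \<epsilon> > 0 \<Longrightarrow> \<exists>i. d x (f i) < \<epsilon>"
    and dense_g: "\<And>y \<epsilon>. y \<in> B \<Longrightarrow> \<epsilon> > 0 \<Longrightarrow> \<exists>i. e y (g i) < \<epsilon>"
    and C: "finite C" "C \<subseteq> A" "A \<subseteq> (\<Union>c\<in>C. Metric_space.mcball A d c r)"
  shows "\<exists>C'. finite C' \<and> card C' \<le> card C \<and> C' \<subseteq> B \<and> B \<subseteq> (\<Union>c\<in>C'. Metric_space.mcball B e c r)"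
proof -
  interpret A: Metric_space A d by (rule A)
  interpret B: Metric_space B e by (rule B(1))
  have "\<forall>c\<in>C. \<exists>y\<in>B. \<forall>j. e y (g j) = d c (f j)"
    using Metric_space_transfer_point[OF A(1) B f g iso dense_f] C(2) by blast
  then obtain \<phi> where \<phi>: "\<And>c. c \<in> C \<Longrightarrow> \<phi> c \<in> B" "\<And>c j. c \<in> C \<Longrightarrow> e (\<phi> c) (g j) = d c (f j)"
    by metis
  have "B \<subseteq> (\<Union>c\<in>\<phi> ` C. B.mcball c r)"
  proof
    fix y assume y: "y \<in> B"
    obtain x where x: "x \<in> A" "\<And>j. d x (f j) = e y (g j)"
      using Metric_space_transfer_point[OF B(1) A g f iso[symmetric] dense_g[OF y] y] by blast
    then obtain c where c: "c \<in> C" "d c x \<le> r"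
      using C(3) by auto
    have cA: "c \<in> A" using c C by auto
    \<comment> \<open>\<open>c\<close> and \<open>y\<close> were transferred separately, so their
      distances are compared through a \<open>g j\<close> near \<open>y\<close>, at the cost of
      \<epsilon>.\<close>
    have "e (\<phi> c) y \<le> r + \<epsilon>" if \<epsilon>: "\<epsilon> > 0" for \<epsilon>
    proof -
      obtain j where j: "e y (g j) < \<epsilon> / 2"
        using dense_g[OF y half_gt_zero[OF \<epsilon>]] by blast
      show ?thesis
        using j x(2)[of j] \<phi>(2)[OF c(1), of j] c(2) B.triangle[OF \<phi>(1)[OF c(1)] g[of j] y] 
          B.commute[of y "g j"] A.triangle[OF cA x(1) f[of j]] by linarith
    qed
    then have "e (\<phi> c) y \<le> r"
      by (rule field_le_epsilon)
    then show "y \<in> (\<Union>c\<in>\<phi> ` C. B.mcball c r)"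
      using c(1) \<phi>(1) y by auto
  qed
  then show ?thesis
    using C(1) \<phi>(1) by (intro exI[of _ "\<phi> ` C"]) (auto simp: card_image_le)
qed

text \<open>If the right-hand space has no finite cover, its infimum in \<open>enat\<close> is
  \<infinity>, so \<open>Inf_mono\<close> covers that case as well.\<close>

lemma covering_number_le:
  assumes "\<And>C. finite C \<Longrightarrow> C \<subseteq> space M \<Longrightarrow>
      space M \<subseteq> (\<Union>c\<in>C. Metric_space.mcball (space M) (nbhd_dist M W) c \<epsilon>) \<Longrightarrow>
      \<exists>C'. finite C' \<and> card C' \<le> card C \<and> C' \<subseteq> space M' \<and>
        space M' \<subseteq> (\<Union>c\<in>C'. Metric_space.mcball (space M') (nbhd_dist M' W') c \<epsilon>)"
  shows "covering_number M' W' \<epsilon> \<le> covering_number M W \<epsilon>"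
  unfolding covering_number_def
proof (rule Inf_mono)
  fix b assume "b \<in> {enat (card C) | C. finite C \<and> C \<subseteq> space M \<and>
       space M \<subseteq> (\<Union>c\<in>C. Metric_space.mcball (space M) (nbhd_dist M W) c \<epsilon>)}"
  then obtain C where C: "b = enat (card C)" "finite C" "C \<subseteq> space M"
     "space M \<subseteq> (\<Union>c\<in>C. Metric_space.mcball (space M) (nbhd_dist M W) c \<epsilon>)" by blast
  from assms[OF C(2-4)] C(1)
  show "\<exists>a\<in>{enat (card C) | C. finite C \<and> C \<subseteq> space M' \<and>
       space M' \<subseteq> (\<Union>c\<in>C. Metric_space.mcball (space M') (nbhd_dist M' W') c \<epsilon>)}. a \<le> b"
    by auto
qed

text \<open>
  The diagonal codegrees, which cannot be read off a random graph, are limits of off-diagonal ones: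
  if \<open>\<omega> j\<close> approaches \<open>\<omega> i\<close>, then the \<open>\<omega>' j\<close> approach \<open>\<omega>' i\<close> weakly, because they do so when tested
  against the other \<open>\<omega>' k\<close>, and \<open>\<omega>' i\<close> itself is a limit of such \<open>\<omega>' k\<close>.
\<close>

lemma codegree_diagonal_eq:
  assumes "graphon M W" "graphon M' W'"
    and \<omega>: "\<And>i::nat. \<omega> i \<in> space M" and \<omega>': "\<And>i. \<omega>' i \<in> space M'"
    and off: "\<And>i j. i \<noteq> j \<Longrightarrow> codegree M W (\<omega> i) (\<omega> j) = codegree M' W' (\<omega>' i) (\<omega>' j)"
    and rec: "\<And>i s \<epsilon>. \<epsilon> > 0 \<Longrightarrow> \<exists>j\<ge>s. nbhd_dist M W (\<omega> i) (\<omega> j) < \<epsilon>"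
    and rec': "\<And>i s \<epsilon>. \<epsilon> > 0 \<Longrightarrow> \<exists>j\<ge>s. nbhd_dist M' W' (\<omega>' i) (\<omega>' j) < \<epsilon>"
  shows "codegree M W (\<omega> i) (\<omega> i) = codegree M' W' (\<omega>' i) (\<omega>' i)"
proof -
  interpret graphon M W by fact
  interpret graphon': graphon M' W' by fact
  let ?K = "\<lambda>i j. codegree M W (\<omega> i) (\<omega> j)" and ?K' = "\<lambda>i j. codegree M' W' (\<omega>' i) (\<omega>' j)"
  have "\<bar>?K i i - ?K' i i\<bar> \<le> \<epsilon>" if "\<epsilon> > 0" for \<epsilon>
  proof -
    \<comment> \<open>The order i < k < j makes the three indices distinct, so \<open>off\<close>
      applies to each pair. The chain runs K i i, K j i = K' i j, K' k j = K j k, K i k = K' k i, K'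
      i i, and each of its four gaps is below \<epsilon> / 4.\<close>
    obtain k where k: "k \<ge> Suc i" "nbhd_dist M' W' (\<omega>' i) (\<omega>' k) < \<epsilon> / 4"
      using rec'[of "\<epsilon> / 4" "Suc i" i] \<open>\<epsilon> > 0\<close> by auto
    obtain j where j: "j \<ge> Suc k" "nbhd_dist M W (\<omega> i) (\<omega> j) < \<epsilon> / 4"
      using rec[of "\<epsilon> / 4" "Suc k" i] \<open>\<epsilon> > 0\<close> by auto
    have "\<bar>?K i i - ?K j i\<bar> < \<epsilon> / 4" "\<bar>?K i k - ?K j k\<bar> < \<epsilon> / 4"
      using codegree_diff_le[OF \<omega>[of i] \<omega>[of j] \<omega>] j(2) order_le_less_trans by blast+
    moreover have "\<bar>?K' i j - ?K' k j\<bar> < \<epsilon> / 4" "\<bar>?K' i i - ?K' k i\<bar> < \<epsilon> / 4"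
      using graphon'.codegree_diff_le[OF \<omega>'[of i] \<omega>'[of k] \<omega>'] k(2) order_le_less_trans by blast+
    moreover have "?K j i = ?K' i j" "?K i k = ?K' k i" "?K j k = ?K' k j"
      using off[of j i] off[of i k] off[of j k] j(1) k(1) by (simp_all add: codegree_def mult.commute)
    ultimately show ?thesis
      by linarith
  qed
  then have "\<bar>?K i i - ?K' i i\<bar> \<le> 0"
    by (rule field_le_epsilon[of _ 0, simplified])
  then show ?thesis by simp
qed

section \<open>Compact sets of recurrent sequences\<close>

text \<open>\<open>mtotally_bounded\<close> asks for centres inside \<open>S\<close>, whereas balls
  around a dense sequence may be centred outside it. Each ball that meets \<open>S\<close> is
  recentred at a point \<open>p x\<close> of \<open>S\<close>.\<close>

lemma (in Metric_space) mtotally_bounded_if_finite_covers: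
  assumes S: "S \<subseteq> M"
    and cover: "\<And>\<epsilon>. \<epsilon> > 0 \<Longrightarrow> \<exists>F. finite F \<and> S \<subseteq> (\<Union>x\<in>F. mcball x \<epsilon>)"
  shows "mtotally_bounded S"
  unfolding mtotally_bounded_def
proof (intro allI impI)
  fix \<epsilon> :: real assume "\<epsilon> > 0"
  \<comment> \<open>Recentring doubles the radius; thirds keep 2 \<epsilon> / 3 strictly below
    \<epsilon>, as open balls require.\<close>
  then obtain F where F: "finite F" "S \<subseteq> (\<Union>x\<in>F. mcball x (\<epsilon> / 3))"
    using cover[of "\<epsilon> / 3"] by auto
  define p where "p x = (SOME y. y \<in> S \<inter> mcball x (\<epsilon> / 3))" for x
  define G where "G = {x \<in> F. S \<inter> mcball x (\<epsilon> / 3) \<noteq> {}}"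
  have p: "p x \<in> S \<inter> mcball x (\<epsilon> / 3)" if "x \<in> G" for x
    unfolding p_def by (rule someI_ex) (use that in \<open>auto simp: G_def\<close>)
  have "S \<subseteq> (\<Union>y\<in>p ` G. mball y \<epsilon>)"
  proof
    fix z assume z: "z \<in> S"
    then obtain x where x: "x \<in> F" "z \<in> mcball x (\<epsilon> / 3)"
      using F(2) by auto
    then have "x \<in> G"
      using z by (auto simp: G_def)
    moreover have "z \<in> mball (p x) \<epsilon>"
      using p[OF \<open>x \<in> G\<close>] x(2) \<open>\<epsilon> > 0\<close> triangle[of "p x" x z] commute[of x "p x"] by auto
    ultimately show "z \<in> (\<Union>y\<in>p ` G. mball y \<epsilon>)"
      by blast
  qed
  moreover have "finite (p ` G)" "p ` G \<subseteq> S"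
    using F(1) p by (auto simp: G_def)
  ultimately show "\<exists>K. finite K \<and> K \<subseteq> S \<and> S \<subseteq> (\<Union>x\<in>K. mball x \<epsilon>)"
    by blast
qed

lemma (in Metric_space) separable_imp_dense_sequence:
  assumes "separable_space mtopology" "M \<noteq> {}"
  shows "\<exists>c :: nat \<Rightarrow> 'a. range c \<subseteq> M \<and> (\<forall>x\<in>M. \<forall>\<epsilon>>0. \<exists>n. d (c n) x < \<epsilon>)"
proof -
  obtain C where C: "countable C" "C \<subseteq> M" "mtopology closure_of C = M"
    using assms(1) by (auto simp: separable_space_def)
  have "C \<noteq> {}"
    using C(3) assms(2) by auto
  then have range: "range (from_nat_into C) = C"
    using C(1) by (simp add: range_from_nat_into)
  have "\<exists>n. d (from_nat_into C n) x < \<epsilon>" if "x \<in> M" "\<epsilon> > 0" for x \<epsilon>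
  proof -
    have "\<exists>y\<in>C. y \<in> mball x \<epsilon>"
      using C(3) that unfolding metric_closure_of by blast
    then show ?thesis
      using range commute by (metis imageE in_mball)
  qed
  then show ?thesis
    using range C(2) by blast
qed

text \<open>A union bound on the complements: the event for condition \<open>n\<close> may fail with
  probability at most \<open>e * (1 / 2) ^ Suc n\<close>, and these allowances sum to
  \<open>e\<close>.\<close>

lemma (in prob_space) prob_Inter_choose_ge:
  assumes "\<And>n e. e > 0 \<Longrightarrow> \<exists>A\<in>events. Q n A \<and> prob A \<ge> 1 - e" and "e > 0"
  shows "\<exists>A :: nat \<Rightarrow> 'a set. (\<forall>n. A n \<in> events \<and> Q n (A n)) \<and> prob (\<Inter>n. A n) \<ge> 1 - e"
proof -
  have "\<forall>n. \<exists>A. A \<in> events \<and> Q n A \<and> prob A \<ge> 1 - e * (1 / 2) ^ Suc n"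
    using assms(1)[of "e * (1 / 2) ^ Suc n" for n] \<open>e > 0\<close> by fastforce
  then obtain A where A: "\<And>n. A n \<in> events" "\<And>n. Q n (A n)" 
    "\<And>n. prob (A n) \<ge> 1 - e * (1 / 2) ^ Suc n"
    by metis
  have sums: "(\<lambda>n. e * (1 / 2) ^ Suc n) sums e"
    using sums_mult[OF power_half_series, of e] by simp
  have le: "prob (space M - A n) \<le> e * (1 / 2) ^ Suc n" for n
    using A(3)[of n] prob_compl[OF A(1)[of n]] by simp
  have summ: "summable (\<lambda>n. prob (space M - A n))"
    using le by (intro summable_comparison_test[OF _ sums_summable[OF sums]]) auto
  have "prob (\<Union>n. space M - A n) \<le> (\<Sum>n. prob (space M - A n))"
    using A(1) summ by (intro finite_measure_subadditive_countably) auto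
  also have "\<dots> \<le> e"
    using suminf_le[OF le summ sums_summable[OF sums]] sums_unique[OF sums] by simp
  finally have "prob (space M - (\<Inter>n. A n)) \<le> e"
    by simp
  moreover have "(\<Inter>n. A n) \<in> events"
    using A(1) by auto
  ultimately have "prob (\<Inter>n. A n) \<ge> 1 - e"
    using prob_compl[of "\<Inter>n. A n"] by simp
  with A show ?thesis by blast
qed

section \<open>Likely closed events for an infinite sample\<close>

context pure_graphon
begin

lemma mcball_events: "mcball x r \<in> events"
proof (cases "x \<in> space M")
  case True
  have "mcball x r = {y \<in> space M. nbhd_dist M W x y \<le> r}"
    using True by auto
  then show ?thesis
    using nbhd_dist_measurable[OF True] by simp
next
  case False
  then have "mcball x r = {}" by auto
  then show ?thesis by simp
qed

lemma prob_mcball_pos: "x \<in> space M \<Longrightarrow> r > 0 \<Longrightarrow> prob (mcball x r) > 0"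
  using full_support[of x r] emeasure_mono[OF mball_subset_mcball mcball_events, of x r]
  by (simp add: emeasure_eq_measure)

text \<open>Continuity of the measure from below, as the balls around the \<open>c n\<close> exhaust
  the space. This is the tightness step of Ulam's theorem.\<close>

lemma prob_finite_cover_ge:
  assumes c: "\<And>x. x \<in> space M \<Longrightarrow> \<exists>n::nat. nbhd_dist M W (c n) x < r" "range c \<subseteq> space M" and "e > 0"
  shows "\<exists>J. prob (\<Union>j<J. mcball (c j) r) \<ge> 1 - e"
proof -
  let ?U = "\<lambda>J. \<Union>j<J. mcball (c j) r"
  have "incseq ?U"
    unfolding incseq_def by (intro allI impI UN_mono) auto
  moreover have "range ?U \<subseteq> events"
    using mcball_events by blast
  ultimately have "(\<lambda>J. prob (?U J)) \<longlonglongrightarrow> prob (\<Union>J. ?U J)"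
    by (intro finite_Lim_measure_incseq)
  moreover have "(\<Union>J. ?U J) = space M"
  proof (intro equalityI subsetI)
    fix x assume x: "x \<in> space M"
    then obtain n where "nbhd_dist M W (c n) x < r"
      using c(1) by blast
    then have "x \<in> ?U (Suc n)"
      using x c(2) by (auto intro!: bexI[of _ n])
    then show "x \<in> (\<Union>J. ?U J)" by blast
  qed auto
  ultimately have "(\<lambda>J. prob (?U J)) \<longlonglongrightarrow> 1"
    by (simp add: prob_space)
  from order_tendstoD(1)[OF this, of "1 - e"] \<open>e > 0\<close>
  obtain J where "1 - e < prob (?U J)"
    by (auto simp: eventually_sequentially)
  then show ?thesis
    using less_imp_le by blast
qed

lemma closedin_coordinate:
  assumes "closedin mtopology C"
  shows "closedin (product_topology (\<lambda>_::nat. mtopology) UNIV) {\<omega> \<in> UNIV \<rightarrow>\<^sub>E space M. \<omega> i \<in> C}"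
  using closedin_continuous_map_preimage[OF continuous_map_product_projection[of i UNIV "\<lambda>_. mtopology"] assms]
  by simp

lemma prob_coordinate:
  assumes "U \<in> events"
  shows "{\<omega> \<in> UNIV \<rightarrow>\<^sub>E space M. \<omega> i \<in> U} \<in> sets (PiM UNIV (\<lambda>_::nat. M))"
    and "measure (PiM UNIV (\<lambda>_::nat. M)) {\<omega> \<in> UNIV \<rightarrow>\<^sub>E space M. \<omega> i \<in> U} = prob U"
proof -
  interpret P: product_prob_space "\<lambda>_::nat. M" UNIV by unfold_locales
  show "{\<omega> \<in> UNIV \<rightarrow>\<^sub>E space M. \<omega> i \<in> U} \<in> sets (PiM UNIV (\<lambda>_::nat. M))"
    using sets_Collect_single'[of i UNIV "\<lambda>_. M" "\<lambda>x. x \<in> U"] assms sets.sets_into_space[OF assms]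
    by (simp add: space_PiM Collect_conj_eq Int_absorb1)
  show "measure (PiM UNIV (\<lambda>_::nat. M)) {\<omega> \<in> UNIV \<rightarrow>\<^sub>E space M. \<omega> i \<in> U} = prob U"
    using P.emeasure_PiM_Collect_single[of i U] assms by (simp add: space_PiM measure_def)
qed

text \<open>By independence, all \<open>J\<close> coordinates of the window miss \<open>U\<close>
  with probability \<open>(1 - prob U) ^ J\<close>, which tends to 0. The window is finite so that
  for closed \<open>U\<close> the event is a finite union of closed sets.\<close>

lemma prob_hit_ge:
  assumes U: "U \<in> events" "prob U > 0" and "e > 0"
  shows "\<exists>J. {\<omega> \<in> UNIV \<rightarrow>\<^sub>E space M. \<exists>i\<in>{s..<s + J}. \<omega> i \<in> U} \<in> sets (PiM UNIV (\<lambda>_::nat. M)) \<and>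
    measure (PiM UNIV (\<lambda>_::nat. M)) {\<omega> \<in> UNIV \<rightarrow>\<^sub>E space M. \<exists>i\<in>{s..<s + J}. \<omega> i \<in> U} \<ge> 1 - e"
proof -
  interpret P: product_prob_space "\<lambda>_::nat. M" UNIV by unfold_locales
  obtain J where J: "(1 - prob U) ^ J < e"
    using real_arch_pow_inv[of e "1 - prob U"] U \<open>e > 0\<close> by auto
  let ?H = "{\<omega> \<in> UNIV \<rightarrow>\<^sub>E space M. \<exists>i\<in>{s..<s + J}. \<omega> i \<in> U}"
  have "?H = (\<Union>i\<in>{s..<s + J}. {\<omega> \<in> UNIV \<rightarrow>\<^sub>E space M. \<omega> i \<in> U})"
    by auto
  also have "\<dots> \<in> P.P.events"
    using prob_coordinate(1)[OF U(1)] by auto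
  finally have H: "?H \<in> P.P.events" .
  have "space (PiM UNIV (\<lambda>_::nat. M)) - ?H
      = {\<omega> \<in> space (PiM UNIV (\<lambda>_::nat. M)). \<forall>i\<in>{s..<s + J}. \<omega> i \<in> space M - U}"
    by (auto simp: space_PiM PiE_iff)
  then have "P.P.prob (space (PiM UNIV (\<lambda>_::nat. M)) - ?H) = (1 - prob U) ^ J"
    using P.emeasure_PiM_Collect[of "{s..<s + J}" "\<lambda>_. space M - U"] U(1)
    by (simp add: P.P.emeasure_eq_measure emeasure_eq_measure prob_compl ennreal_power)
  then show ?thesis
    using J H P.P.prob_compl[OF H] by (intro exI[of _ J]) auto
qed

text \<open>Countably many likely closed conditions are intersected: coordinate \<open>i\<close>
  lies in finitely many balls of radius \<open>1 / Suc q\<close> (tightness), or some coordinate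
  from \<open>s\<close> on lies in a given such ball (recurrence). The first kind confines the
  sequences to a product of compact sets, the second makes them visit every ball infinitely
  often.\<close>

lemma compact_recurrent_set:
  "\<exists>K. K \<in> sets (PiM UNIV (\<lambda>_::nat. M)) \<and> compactin (product_topology (\<lambda>_::nat. mtopology) UNIV) K \<and>
    measure (PiM UNIV (\<lambda>_::nat. M)) K \<ge> 2 / 3 \<and>
    (\<forall>\<omega>\<in>K. \<forall>x\<in>space M. \<forall>\<epsilon>>0. \<forall>s. \<exists>j\<ge>s. nbhd_dist M W x (\<omega> j) < \<epsilon>)"
proof -
  interpret P: product_prob_space "\<lambda>_::nat. M" UNIV by unfold_locales
  let ?T = "product_topology (\<lambda>_::nat. mtopology) UNIV"
  obtain c :: "nat \<Rightarrow> 'a" where c: "range c \<subseteq> space M"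
      "\<And>x \<epsilon>. x \<in> space M \<Longrightarrow> \<epsilon> > 0 \<Longrightarrow> \<exists>n. nbhd_dist M W (c n) x < \<epsilon>"
    using separable_imp_dense_sequence[OF separable not_empty] by blast
  define B where "B j q = mcball (c j) (1 / Suc q)" for j q
  have B: "closedin mtopology (B j q)" "B j q \<in> events" "prob (B j q) > 0" for j q
    using mcball_events prob_mcball_pos[of "c j" "1 / Suc q"] subsetD[OF c(1) rangeI[of c j]]
    by (simp_all add: B_def)
  \<comment> \<open>Both properties pass to subsets of \<open>\<Omega>\<close>, hence from a single
    \<open>A n\<close> to the whole intersection.\<close>
  define Tight where "Tight i q \<Omega> = (\<exists>J. \<Omega> \<subseteq> {\<omega>. \<omega> i \<in> (\<Union>j<J. B j q)})" for i q :: nat and \<Omega> :: "(nat \<Rightarrow> 'a) set"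
  define Hit where "Hit j q s \<Omega> = (\<Omega> \<subseteq> {\<omega>. \<exists>i\<ge>s. \<omega> i \<in> B j q})" for j q s :: nat and \<Omega> :: "(nat \<Rightarrow> 'a) set"
  \<comment> \<open>Decoding indices of a countable sum type with \<open>from_nat\<close> puts both
    kinds of conditions into one sequence for \<open>prob_Inter_choose_ge\<close>.\<close>
  define Q where "Q n \<Omega> = (closedin ?T \<Omega> \<and>
     (case from_nat n of Inl (i, q) \<Rightarrow> Tight i q \<Omega> | Inr (j, q, s) \<Rightarrow> Hit j q s \<Omega>))" for n \<Omega>
  have choose: "\<exists>A\<in>P.P.events. Q n A \<and> P.P.prob A \<ge> 1 - e" if e: "e > 0" for n e
  proof (cases "from_nat n :: nat \<times> nat + nat \<times> nat \<times> nat")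
    case (Inl p)
    then obtain i q where n: "from_nat n = (Inl (i, q) :: nat \<times> nat + nat \<times> nat \<times> nat)"
      by (cases p) auto
    obtain J where J: "prob (\<Union>j<J. B j q) \<ge> 1 - e"
      using prob_finite_cover_ge[of c "1 / Suc q" e] c e by (auto simp: B_def)
    let ?A = "{\<omega> \<in> UNIV \<rightarrow>\<^sub>E space M. \<omega> i \<in> (\<Union>j<J. B j q)}"
    have "closedin ?T ?A"
      using B(1) by (intro closedin_coordinate closedin_Union) auto
    moreover have "Tight i q ?A"
      unfolding Tight_def by blast
    moreover have ev: "(\<Union>j<J. B j q) \<in> events"
      using B(2) by (intro sets.finite_UN) auto
    ultimately show ?thesis
      using prob_coordinate[OF ev, of i] J by (intro bexI[of _ ?A]) (simp_all add: Q_def n)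
  next
    case (Inr p)
    then obtain j q s where n: "from_nat n = (Inr (j, q, s) :: nat \<times> nat + nat \<times> nat \<times> nat)"
      by (cases p) auto
    obtain J where J: "{\<omega> \<in> UNIV \<rightarrow>\<^sub>E space M. \<exists>i\<in>{s..<s + J}. \<omega> i \<in> B j q} \<in> P.P.events"
        "P.P.prob {\<omega> \<in> UNIV \<rightarrow>\<^sub>E space M. \<exists>i\<in>{s..<s + J}. \<omega> i \<in> B j q} \<ge> 1 - e"
      using prob_hit_ge[OF B(2,3) e, of s j q] by blast
    let ?A = "{\<omega> \<in> UNIV \<rightarrow>\<^sub>E space M. \<exists>i\<in>{s..<s + J}. \<omega> i \<in> B j q}"
    have "?A = (\<Union>i\<in>{s..<s + J}. {\<omega> \<in> UNIV \<rightarrow>\<^sub>E space M. \<omega> i \<in> B j q})"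
      by auto
    also have "closedin ?T \<dots>"
      using closedin_coordinate[OF B(1)] by (intro closedin_Union) auto
    finally have "closedin ?T ?A" .
    moreover have "Hit j q s ?A"
      unfolding Hit_def by auto
    ultimately show ?thesis
      using J by (intro bexI[of _ ?A]) (simp_all add: Q_def n)
  qed
  \<comment> \<open>A total loss of 1/3 leaves mass 2/3, above 1/2 with room for the sampling error
    1/12 allowed later.\<close>
  have "\<exists>A. (\<forall>n. A n \<in> P.P.events \<and> Q n (A n)) \<and> P.P.prob (\<Inter>n. A n) \<ge> 1 - 1 / 3"
    by (rule P.P.prob_Inter_choose_ge[OF choose]) simp_all
  then obtain A where A: "\<And>n. A n \<in> P.P.events" "\<And>n. Q n (A n)" "P.P.prob (\<Inter>n. A n) \<ge> 2 / 3"
    by auto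
  let ?K = "\<Inter>n. A n"
  have closed: "closedin ?T ?K"
    using A(2) by (intro closedin_Inter) (auto simp: Q_def)
  have Tight: "Tight i q ?K" for i q
  proof -
    have "Tight i q (A (to_nat (Inl (i, q) :: nat \<times> nat + nat \<times> nat \<times> nat)))"
      using A(2)[of "to_nat (Inl (i, q) :: nat \<times> nat + nat \<times> nat \<times> nat)"] by (simp add: Q_def)
    then show ?thesis
      unfolding Tight_def by (meson INF_lower UNIV_I order_trans)
  qed
  have Hit: "Hit j q s ?K" for j q s
  proof -
    have "Hit j q s (A (to_nat (Inr (j, q, s) :: nat \<times> nat + nat \<times> nat \<times> nat)))"
      using A(2)[of "to_nat (Inr (j, q, s) :: nat \<times> nat + nat \<times> nat \<times> nat)"] by (simp add: Q_def)
    then show ?thesis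
      unfolding Hit_def by (meson INF_lower UNIV_I order_trans)
  qed
  have sub: "?K \<subseteq> UNIV \<rightarrow>\<^sub>E space M"
    using closedin_subset[OF closed] by simp
  have "compactin ?T ?K"
  proof -
    obtain J where J: "\<And>i q. ?K \<subseteq> {\<omega>. \<omega> i \<in> (\<Union>j<J i q. B j q)}"
      using Tight unfolding Tight_def by metis
    \<comment> \<open>Each \<open>S i\<close> is closed and totally bounded, hence compact by
      completeness. Tychonoff's theorem makes their product compact, and \<open>?K\<close> is a
      closed subset of it.\<close>
    define S where "S i = (\<Inter>q. \<Union>j<J i q. B j q)" for i
    have "closedin mtopology (S i)" for i
      unfolding S_def using B(1) by (intro closedin_Inter) (auto intro!: closedin_Union)
    moreover have "mtotally_bounded (S i)" for i
    proof (rule mtotally_bounded_if_finite_covers)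
      show "S i \<subseteq> space M"
        using closedin_subset[OF calculation] by simp
      fix \<epsilon> :: real assume "\<epsilon> > 0"
      then obtain q where q: "1 / Suc q < \<epsilon>"
        using nat_approx_posE by blast
      have "S i \<subseteq> (\<Union>j<J i q. B j q)"
        unfolding S_def by blast
      also have "\<dots> \<subseteq> (\<Union>x\<in>c ` {..<J i q}. mcball x \<epsilon>)"
        using q mcball_subset_concentric[of "1 / Suc q" \<epsilon>] by (fastforce simp: B_def)
      finally show "\<exists>F. finite F \<and> S i \<subseteq> (\<Union>x\<in>F. mcball x \<epsilon>)"
        by blast
    qed
    ultimately have "compactin mtopology (S i)" for i
      using mtotally_bounded_eq_compact_closure_of[OF complete, of "S i"] by (simp add: closure_of_closedin)
    then have "compactin ?T (PiE UNIV S)"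
      by (simp add: compactin_PiE)
    moreover have "?K \<subseteq> PiE UNIV S"
      using J by (fastforce simp: S_def)
    ultimately show ?thesis
      using closed by (rule closed_compactin)
  qed
  moreover have "\<exists>j\<ge>s. nbhd_dist M W x (\<omega> j) < \<epsilon>"
    if \<omega>: "\<omega> \<in> ?K" and x: "x \<in> space M" and \<epsilon>: "\<epsilon> > 0" for \<omega> x \<epsilon> s
  proof -
    obtain n where n: "nbhd_dist M W (c n) x < \<epsilon> / 2"
      using c(2)[OF x half_gt_zero[OF \<epsilon>]] by blast
    obtain q where q: "1 / Suc q < \<epsilon> / 2"
      using nat_approx_posE[OF half_gt_zero[OF \<epsilon>]] by blast
    obtain j where j: "j \<ge> s" "\<omega> j \<in> mcball (c n) (1 / Suc q)"
      using Hit[of n q s] \<omega> unfolding Hit_def B_def by blast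
    then have "nbhd_dist M W x (\<omega> j) < \<epsilon>"
      using n q triangle[of x "c n" "\<omega> j"] x commute[of x "c n"] by auto
    with j(1) show ?thesis by blast
  qed
  moreover have "?K \<in> P.P.events"
    using A(1) by auto
  ultimately show ?thesis
    using A(3) by (intro exI[of _ ?K]) blast
qed

end

section \<open>Common neighbours in the random graph\<close>

text \<open>Padding with the factor 1 off \<open>F\<close> extends the product to all of
  \<open>E\<close>, where independence of the coordinates factorises the expectation.\<close>

lemma expectation_edges_Pi_pmf:
  assumes E: "finite E" "F \<subseteq> E" and p: "\<And>e. e \<in> F \<Longrightarrow> p e \<in> {0..1}"
  shows "measure_pmf.expectation (Pi_pmf E False (\<lambda>e. bernoulli_pmf (p e)))
           (\<lambda>X. \<Prod>e\<in>F. of_bool (X e) :: real) = (\<Prod>e\<in>F. p e)"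
proof -
  let ?f = "\<lambda>e x. if e \<in> F then of_bool x else 1 :: real"
  have prod_F: "(\<Prod>e\<in>E. if e \<in> F then h e else 1) = prod h F" for h :: "'a \<Rightarrow> real"
    using E by (simp add: prod.If_cases Int_absorb1)
  have "measure_pmf.expectation (Pi_pmf E False (\<lambda>e. bernoulli_pmf (p e))) (\<lambda>X. \<Prod>e\<in>E. ?f e (X e))
      = (\<Prod>e\<in>E. measure_pmf.expectation (bernoulli_pmf (p e)) (?f e))"
    using E by (intro expectation_prod_Pi_pmf) (auto intro: integrable_measure_pmf_finite)
  also have "\<dots> = (\<Prod>e\<in>E. if e \<in> F then p e else 1)"
    using p by (intro prod.cong) auto
  finally show ?thesis
    by (simp only: prod_F)
qed

lemma finite_set_adjacency_pmf: "finite (set_pmf (adjacency_pmf W n \<omega>))"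
proof -
  have fin: "finite {(i, j). i < j \<and> j < n}"
    by (rule finite_subset[of _ "{..<n} \<times> {..<n}"]) auto
  show ?thesis
    unfolding adjacency_pmf_def using fin by (auto simp: set_Pi_pmf intro!: finite_PiE_dflt)
qed

lemma adjacency_pmf_range: "A \<in> set_pmf (adjacency_pmf W n \<omega>) \<Longrightarrow> A i j \<le> 1"
  by (auto simp: adjacency_pmf_def)

text \<open>Lets positions be read from an infinite sequence although \<open>random_graph\<close>
  samples only the first \<open>n\<close>.\<close>

lemma adjacency_pmf_restrict: "adjacency_pmf W n (restrict \<omega> {..<n}) = adjacency_pmf W n \<omega>"
  unfolding adjacency_pmf_def
  by (intro arg_cong[where f = "map_pmf _"] Pi_pmf_cong) auto

context graphon
begin

lemma expectation_edges_adjacency_pmf: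
  assumes \<omega>: "\<And>i. i < n \<Longrightarrow> \<omega> i \<in> space M" and F: "F \<subseteq> {(i, j). i < j \<and> j < n}"
  shows "measure_pmf.expectation (adjacency_pmf W n \<omega>) (\<lambda>A. \<Prod>(i, j)\<in>F. real (A i j))
       = (\<Prod>(i, j)\<in>F. W (\<omega> i) (\<omega> j))"
proof -
  let ?E = "{(i, j). i < j \<and> j < n}"
  have fin: "finite ?E"
    by (rule finite_subset[of _ "{..<n} \<times> {..<n}"]) auto
  have "measure_pmf.expectation (adjacency_pmf W n \<omega>) (\<lambda>A. \<Prod>(i, j)\<in>F. real (A i j))
      = measure_pmf.expectation (Pi_pmf ?E False (\<lambda>e. bernoulli_pmf (W (\<omega> (fst e)) (\<omega> (snd e)))))
          (\<lambda>X. \<Prod>(i, j)\<in>F. of_bool (X (min i j, max i j)))"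
    unfolding adjacency_pmf_def integral_map_pmf by (simp add: case_prod_unfold)
  \<comment> \<open>Pairs in \<open>F\<close> satisfy i < j, so \<open>min\<close> and
    \<open>max\<close> return them unchanged.\<close>
  also have "(\<lambda>X. \<Prod>(i, j)\<in>F. of_bool (X (min i j, max i j))) = (\<lambda>X. \<Prod>e\<in>F. of_bool (X e) :: real)"
    using F by (intro ext prod.cong) (auto simp: min_def max_def)
  also have "measure_pmf.expectation (Pi_pmf ?E False (\<lambda>e. bernoulli_pmf (W (\<omega> (fst e)) (\<omega> (snd e))))) \<dots>
      = (\<Prod>e\<in>F. W (\<omega> (fst e)) (\<omega> (snd e)))"
  proof (rule expectation_edges_Pi_pmf[OF fin F])
    fix e assume "e \<in> F"
    then have "fst e < n" "snd e < n"
      using F by auto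
    then show "W (\<omega> (fst e)) (\<omega> (snd e)) \<in> {0..1}"
      by (intro W_range \<omega>)
  qed
  finally show ?thesis
    by (simp add: case_prod_unfold)
qed

section \<open>Conditional moments of common-neighbour counts\<close>

text \<open>The conditional mean of \<open>A i k * A j k - codegree M W (\<omega> i) (\<omega> j)\<close> given \<open>\<omega>\<close>.\<close>

definition codegree_error :: "nat \<Rightarrow> nat \<Rightarrow> (nat \<Rightarrow> 'a) \<Rightarrow> nat \<Rightarrow> real" where
  "codegree_error i j \<omega> k = W (\<omega> i) (\<omega> k) * W (\<omega> j) (\<omega> k) - codegree M W (\<omega> i) (\<omega> j)"

text \<open>Given \<open>\<omega>\<close>, the edges ik, jk, il, jl are distinct and independent, so
  the expectation factorises. As i and j are below k and l, every pair is already ordered as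
  \<open>expectation_edges_adjacency_pmf\<close> requires.\<close>

lemma expectation_common_neighbours_mult:
  assumes \<omega>: "\<And>i. i < n \<Longrightarrow> \<omega> i \<in> space M"
    and neq: "i \<noteq> j" "k \<noteq> l" and less: "i < k" "j < k" "i < l" "j < l" "k < n" "l < n"
  shows "measure_pmf.expectation (adjacency_pmf W n \<omega>) (\<lambda>A.
      (real (A i k * A j k) - codegree M W (\<omega> i) (\<omega> j)) *
      (real (A i l * A j l) - codegree M W (\<omega> i) (\<omega> j)))
    = codegree_error i j \<omega> k * codegree_error i j \<omega> l"
proof -
  let ?p = "adjacency_pmf W n \<omega>" and ?c = "codegree M W (\<omega> i) (\<omega> j)"
  have int: "integrable (measure_pmf ?p) f" for f :: "_ \<Rightarrow> real"
    by (intro integrable_measure_pmf_finite finite_set_adjacency_pmf)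
  have k: "measure_pmf.expectation ?p (\<lambda>A. real (A i k) * real (A j k)) = W (\<omega> i) (\<omega> k) * W (\<omega> j) (\<omega> k)"
    using expectation_edges_adjacency_pmf[of n \<omega> "{(i, k), (j, k)}", OF \<omega>] neq less by simp
  have l: "measure_pmf.expectation ?p (\<lambda>A. real (A i l) * real (A j l)) = W (\<omega> i) (\<omega> l) * W (\<omega> j) (\<omega> l)"
    using expectation_edges_adjacency_pmf[of n \<omega> "{(i, l), (j, l)}", OF \<omega>] neq less by simp
  have kl: "measure_pmf.expectation ?p (\<lambda>A. real (A i k) * (real (A j k) * (real (A i l) * real (A j l))))
      = W (\<omega> i) (\<omega> k) * (W (\<omega> j) (\<omega> k) * (W (\<omega> i) (\<omega> l) * W (\<omega> j) (\<omega> l)))"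
    using expectation_edges_adjacency_pmf[of n \<omega> "{(i, k), (j, k), (i, l), (j, l)}", OF \<omega>] neq less by simp
  have "measure_pmf.expectation ?p (\<lambda>A. (real (A i k * A j k) - ?c) * (real (A i l * A j l) - ?c))
      = measure_pmf.expectation ?p (\<lambda>A. real (A i k) * (real (A j k) * (real (A i l) * real (A j l)))
          - ?c * (real (A i k) * real (A j k)) - ?c * (real (A i l) * real (A j l)) + ?c * ?c)"
    by (simp add: algebra_simps)
  also have "\<dots> = W (\<omega> i) (\<omega> k) * (W (\<omega> j) (\<omega> k) * (W (\<omega> i) (\<omega> l) * W (\<omega> j) (\<omega> l)))
      - ?c * (W (\<omega> i) (\<omega> k) * W (\<omega> j) (\<omega> k)) - ?c * (W (\<omega> i) (\<omega> l) * W (\<omega> j) (\<omega> l)) + ?c * ?c"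
    by (simp add: int k l kl)
  also have "\<dots> = codegree_error i j \<omega> k * codegree_error i j \<omega> l"
    by (simp add: codegree_error_def algebra_simps)
  finally show ?thesis .
qed

text \<open>When the square is expanded, each of the n - N diagonal terms is at most 1 because the
  summands lie in [-1, 1]; off the diagonal \<open>expectation_common_neighbours_mult\<close> is
  exact.\<close>

lemma expectation_common_neighbours_square_le:
  assumes \<omega>: "\<And>i. i < n \<Longrightarrow> \<omega> i \<in> space M" and "i \<noteq> j" "i < N" "j < N" "N \<le> n"
  shows "measure_pmf.expectation (adjacency_pmf W n \<omega>)
      (\<lambda>A. (\<Sum>k=N..<n. real (A i k * A j k) - codegree M W (\<omega> i) (\<omega> j))\<^sup>2)
    \<le> real (n - N) + (\<Sum>k=N..<n. \<Sum>l\<in>{N..<n} - {k}. codegree_error i j \<omega> k * codegree_error i j \<omega> l)"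
proof -
  let ?p = "adjacency_pmf W n \<omega>" and ?c = "codegree M W (\<omega> i) (\<omega> j)"
  let ?Y = "\<lambda>A k. real (A i k * A j k) - ?c"
  have int: "integrable (measure_pmf ?p) f" for f :: "_ \<Rightarrow> real"
    by (intro integrable_measure_pmf_finite finite_set_adjacency_pmf)
  have "?c \<in> {0..1}"
    using assms by (intro codegree_range \<omega>) auto
  then have "(?Y A k)\<^sup>2 \<le> 1" if "A \<in> set_pmf ?p" for A k
    using adjacency_pmf_range[OF that, of i k] adjacency_pmf_range[OF that, of j k]
    by (auto simp: abs_square_le_1 le_Suc_eq)
  then have diag: "measure_pmf.expectation ?p (\<lambda>A. ?Y A k * ?Y A k) \<le> 1" for k
    using measure_pmf.integral_le_const[OF int, of "\<lambda>A. ?Y A k * ?Y A k" 1]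
    by (auto simp: AE_measure_pmf_iff power2_eq_square)
  have "measure_pmf.expectation ?p (\<lambda>A. (\<Sum>k=N..<n. ?Y A k)\<^sup>2)
      = (\<Sum>k=N..<n. \<Sum>l=N..<n. measure_pmf.expectation ?p (\<lambda>A. ?Y A k * ?Y A l))"
    by (simp add: power2_eq_square sum_product int)
  also have "\<dots> = (\<Sum>k=N..<n. measure_pmf.expectation ?p (\<lambda>A. ?Y A k * ?Y A k)
      + (\<Sum>l\<in>{N..<n} - {k}. measure_pmf.expectation ?p (\<lambda>A. ?Y A k * ?Y A l)))"
    by (intro sum.cong refl sum.remove) auto
  also have "\<dots> \<le> (\<Sum>k=N..<n. 1 + (\<Sum>l\<in>{N..<n} - {k}. codegree_error i j \<omega> k * codegree_error i j \<omega> l))"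
  proof (intro sum_mono add_mono diag)
    fix k l assume "k \<in> {N..<n}" "l \<in> {N..<n} - {k}"
    then show "measure_pmf.expectation ?p (\<lambda>A. ?Y A k * ?Y A l)
        \<le> codegree_error i j \<omega> k * codegree_error i j \<omega> l"
      using assms by (intro eq_refl expectation_common_neighbours_mult \<omega>) auto
  qed
  also have "\<dots> = real (n - N) + (\<Sum>k=N..<n. \<Sum>l\<in>{N..<n} - {k}. codegree_error i j \<omega> k * codegree_error i j \<omega> l)"
    by (simp add: sum.distrib)
  finally show ?thesis .
qed

lemma codegree_error_integrable:
  assumes "i < n" "j < n" "k < n" "l < n"
  shows "integrable (PiM {..<n} (\<lambda>_. M)) (\<lambda>\<omega>. codegree_error i j \<omega> k * codegree_error i j \<omega> l)"
proof -
  let ?P = "PiM {..<n} (\<lambda>_. M)"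
  interpret P: prob_space ?P
    by (intro prob_space_PiM) unfold_locales
  have pair: "(\<lambda>\<omega>. (\<omega> a, \<omega> b)) \<in> measurable ?P (M \<Otimes>\<^sub>M M)" if "a < n" "b < n" for a b
    using that by (intro measurable_Pair measurable_component_singleton) auto
  have W: "(\<lambda>\<omega>. W (\<omega> a) (\<omega> b)) \<in> borel_measurable ?P" if "a < n" "b < n" for a b
    using measurable_compose[OF pair[OF that] W_measurable] by simp
  have c: "(\<lambda>\<omega>. codegree M W (\<omega> a) (\<omega> b)) \<in> borel_measurable ?P" if "a < n" "b < n" for a b
    using measurable_compose[OF pair[OF that] codegree_measurable] by simp
  have "\<bar>codegree_error i j \<omega> k\<bar> \<le> 1" if "k < n" "\<omega> \<in> space ?P" for k \<omega>
  proof -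
    have \<omega>: "\<omega> a \<in> space M" if "a < n" for a
      using \<open>\<omega> \<in> space ?P\<close> that by (auto simp: space_PiM PiE_iff)
    have "W (\<omega> i) (\<omega> k) * W (\<omega> j) (\<omega> k) \<in> {0..1}"
      using W_range[OF \<omega>[OF assms(1)] \<omega>[OF \<open>k < n\<close>]] W_range[OF \<omega>[OF assms(2)] \<omega>[OF \<open>k < n\<close>]]
      by (auto intro: mult_le_one)
    moreover have "codegree M W (\<omega> i) (\<omega> j) \<in> {0..1}"
      using assms \<omega> by (intro codegree_range)
    ultimately show ?thesis
      unfolding codegree_error_def by auto
  qed
  then have "norm (codegree_error i j \<omega> k * codegree_error i j \<omega> l) \<le> 1" if "\<omega> \<in> space ?P" for \<omega>
    using assms that by (auto simp: abs_mult intro!: mult_le_one)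
  then show ?thesis
    using assms by (intro P.integrable_const_bound[where B = 1] AE_I2)
      (auto simp: codegree_error_def intro!: borel_measurable_times borel_measurable_diff W c)
qed

text \<open>Coordinate \<open>l\<close> is integrated out first. The factor for \<open>k\<close>
  does not involve it, and the factor for \<open>l\<close> has mean 0 by the definition of
  \<open>codegree\<close>.\<close>

lemma codegree_error_orthogonal:
  assumes "distinct [i, j, k, l]" "i < n" "j < n" "k < n" "l < n"
  shows "(LINT \<omega>|PiM {..<n} (\<lambda>_. M). codegree_error i j \<omega> k * codegree_error i j \<omega> l) = 0"
proof -
  interpret P: product_sigma_finite "\<lambda>_::nat. M" by unfold_locales
  have ins: "insert l ({..<n} - {l}) = {..<n}"
    using assms by auto
  have "(LINT \<omega>|PiM {..<n} (\<lambda>_. M). codegree_error i j \<omega> k * codegree_error i j \<omega> l)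
      = (LINT \<omega>|PiM ({..<n} - {l}) (\<lambda>_. M). (LINT y|M.
          codegree_error i j (fun_upd \<omega> l y) k * codegree_error i j (fun_upd \<omega> l y) l))"
    using P.product_integral_insert[of "{..<n} - {l}" l
        "\<lambda>\<omega>. codegree_error i j \<omega> k * codegree_error i j \<omega> l", unfolded ins]
      codegree_error_integrable[of i n j k l] assms
    by simp
  also have "\<dots> = (LINT \<omega>|PiM ({..<n} - {l}) (\<lambda>_. M). 0)"
  proof (rule Bochner_Integration.integral_cong[OF refl])
    fix \<omega> assume "\<omega> \<in> space (PiM ({..<n} - {l}) (\<lambda>_. M))"
    then have "\<omega> i \<in> space M" "\<omega> j \<in> space M"
      using assms by (auto simp: space_PiM PiE_iff)
    then show "(LINT y|M. codegree_error i j (fun_upd \<omega> l y) k * codegree_error i j (fun_upd \<omega> l y) l) = 0"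
      using assms(1) integrable_section_mult[of "\<omega> i" "\<omega> j"]
      by (simp add: codegree_error_def prob_space flip: codegree_def)
  qed
  finally show ?thesis by simp
qed

text \<open>Common neighbours are counted only among the vertices from \<open>N\<close> on, while
  the compared vertices lie below \<open>N\<close>. This keeps i and j below every k, so that all
  entries used belong to the upper triangle.\<close>

definition codegrees_close :: "nat \<Rightarrow> nat \<Rightarrow> real \<Rightarrow> (nat \<Rightarrow> 'a) \<Rightarrow> (nat \<Rightarrow> nat \<Rightarrow> nat) \<Rightarrow> bool" where
  "codegrees_close N n \<delta> \<omega> A \<longleftrightarrow> (\<forall>i<N. \<forall>j<N. i \<noteq> j \<longrightarrow>
     \<bar>\<Sum>k=N..<n. real (A i k * A j k) - codegree M W (\<omega> i) (\<omega> j)\<bar> < \<delta> * real (n - N))"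

text \<open>
  Bounds the conditional second moment, given \<open>\<omega>\<close>, of the sum in \<open>codegrees_close\<close>; the double sum
  integrates to \<open>0\<close>.
\<close>

definition codegree_variance :: "nat \<Rightarrow> nat \<Rightarrow> nat \<times> nat \<Rightarrow> (nat \<Rightarrow> 'a) \<Rightarrow> real" where
  "codegree_variance N n = (\<lambda>(i, j) \<omega>.
     real (n - N) + (\<Sum>k=N..<n. \<Sum>l\<in>{N..<n} - {k}. codegree_error i j \<omega> k * codegree_error i j \<omega> l))"

lemma integrable_codegree_variance:
  assumes "i < N" "j < N" "N \<le> n"
  shows "integrable (PiM {..<n} (\<lambda>_. M)) (codegree_variance N n (i, j))"
proof -
  interpret P: prob_space "PiM {..<n} (\<lambda>_. M)"
    by (intro prob_space_PiM) unfold_locales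
  show ?thesis
    unfolding codegree_variance_def using assms
    by (auto intro!: Bochner_Integration.integrable_add Bochner_Integration.integrable_sum codegree_error_integrable)
qed

lemma integral_codegree_variance:
  assumes "i < N" "j < N" "i \<noteq> j" "N \<le> n"
  shows "(LINT \<omega>|PiM {..<n} (\<lambda>_. M). codegree_variance N n (i, j) \<omega>) = real (n - N)"
proof -
  interpret P: prob_space "PiM {..<n} (\<lambda>_. M)"
    by (intro prob_space_PiM) unfold_locales
  have int: "integrable (PiM {..<n} (\<lambda>_. M)) (\<lambda>\<omega>. codegree_error i j \<omega> k * codegree_error i j \<omega> l)"
    if "k < n" "l < n" for k l
    using that assms by (intro codegree_error_integrable) auto
  have "(LINT \<omega>|PiM {..<n} (\<lambda>_. M). codegree_variance N n (i, j) \<omega>)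
      = real (n - N) + (LINT \<omega>|PiM {..<n} (\<lambda>_. M).
          (\<Sum>k=N..<n. \<Sum>l\<in>{N..<n} - {k}. codegree_error i j \<omega> k * codegree_error i j \<omega> l))"
    unfolding codegree_variance_def prod.case
    by (subst Bochner_Integration.integral_add)
      (auto intro!: Bochner_Integration.integrable_sum int simp: P.prob_space)
  also have "(LINT \<omega>|PiM {..<n} (\<lambda>_. M).
          (\<Sum>k=N..<n. \<Sum>l\<in>{N..<n} - {k}. codegree_error i j \<omega> k * codegree_error i j \<omega> l))
      = (\<Sum>k=N..<n. LINT \<omega>|PiM {..<n} (\<lambda>_. M).
          (\<Sum>l\<in>{N..<n} - {k}. codegree_error i j \<omega> k * codegree_error i j \<omega> l))"
    by (intro Bochner_Integration.integral_sum Bochner_Integration.integrable_sum int) auto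
  also have "\<dots> = (\<Sum>k=N..<n. \<Sum>l\<in>{N..<n} - {k}.
          LINT \<omega>|PiM {..<n} (\<lambda>_. M). codegree_error i j \<omega> k * codegree_error i j \<omega> l)"
    by (intro sum.cong refl Bochner_Integration.integral_sum int) auto
  also have "\<dots> = (\<Sum>k=N..<n. \<Sum>l\<in>{N..<n} - {k}. 0)"
    using assms by (intro sum.cong refl codegree_error_orthogonal) auto
  finally show ?thesis by simp
qed

text \<open>Chebyshev's inequality for each pair below \<open>N\<close>, then a union bound over the
  pairs. \<open>codegree_variance\<close> stands in for the conditional second moment because its
  mean over \<open>\<omega>\<close> is explicit.\<close>

lemma prob_codegrees_close_ge:
  assumes \<omega>: "\<And>i. i < n \<Longrightarrow> \<omega> i \<in> space M" and n: "N < n" and \<delta>: "\<delta> > 0"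
  shows "measure (adjacency_pmf W n \<omega>) {A. codegrees_close N n \<delta> \<omega> A}
    \<ge> 1 - (\<Sum>p\<in>{(i, j). i < N \<and> j < N \<and> i \<noteq> j}. codegree_variance N n p \<omega> / (\<delta> * real (n - N))\<^sup>2)"
proof -
  let ?p = "measure_pmf (adjacency_pmf W n \<omega>)" and ?I = "{(i, j). i < N \<and> j < N \<and> i \<noteq> j}"
  let ?t = "\<delta> * real (n - N)"
  let ?S = "\<lambda>(i, j) A. \<Sum>k=N..<n. real (A i k * A j k) - codegree M W (\<omega> i) (\<omega> j)"
  have fin: "finite ?I"
    by (rule finite_subset[of _ "{..<N} \<times> {..<N}"]) auto
  have t: "?t > 0"
    using n \<delta> by simp
  have int: "integrable ?p f" for f :: "_ \<Rightarrow> real"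
    by (intro integrable_measure_pmf_finite finite_set_adjacency_pmf)
  have markov: "measure ?p {A. \<bar>?S p A\<bar> \<ge> ?t} \<le> codegree_variance N n p \<omega> / ?t\<^sup>2" if p_in: "p \<in> ?I" for p
  proof -
    obtain i j where p: "p = (i, j)" "i < N" "j < N" "i \<noteq> j"
      using p_in by auto
    have "(?S p A)\<^sup>2 \<ge> ?t\<^sup>2 \<longleftrightarrow> \<bar>?S p A\<bar> \<ge> ?t" for A
      using abs_le_square_iff[of ?t "?S p A"] t by (simp only: abs_of_pos)
    then have "measure ?p {A. \<bar>?S p A\<bar> \<ge> ?t} = measure ?p {A \<in> space ?p. (?S p A)\<^sup>2 \<ge> ?t\<^sup>2}"
      by simp
    also have "\<dots> \<le> measure_pmf.expectation (adjacency_pmf W n \<omega>) (\<lambda>A. (?S p A)\<^sup>2) / ?t\<^sup>2"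
      using t by (intro integral_Markov_inequality_measure[where A = UNIV] int) auto
    also have "\<dots> \<le> codegree_variance N n p \<omega> / ?t\<^sup>2"
      unfolding codegree_variance_def p(1) prod.case
      using p n by (intro divide_right_mono expectation_common_neighbours_square_le \<omega>) auto
    finally show ?thesis .
  qed
  have "1 - measure ?p {A. codegrees_close N n \<delta> \<omega> A} = measure ?p (UNIV - {A. codegrees_close N n \<delta> \<omega> A})"
    using measure_pmf.prob_compl[of "{A. codegrees_close N n \<delta> \<omega> A}" "adjacency_pmf W n \<omega>"] by simp
  also have "\<dots> \<le> measure ?p (\<Union>p\<in>?I. {A. \<bar>?S p A\<bar> \<ge> ?t})"
    by (intro measure_pmf.finite_measure_mono) (auto simp: codegrees_close_def not_less)
  also have "\<dots> \<le> (\<Sum>p\<in>?I. measure ?p {A. \<bar>?S p A\<bar> \<ge> ?t})"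
    using fin by (intro measure_pmf.finite_measure_subadditive_finite) auto
  also have "\<dots> \<le> (\<Sum>p\<in>?I. codegree_variance N n p \<omega> / ?t\<^sup>2)"
    by (intro sum_mono markov)
  finally show ?thesis by simp
qed

text \<open>The existential over \<open>K\<close> raises no measurability issue, since graphs form a discrete space.\<close>

lemma random_graph_codegrees_close_ge:
  assumes K: "K \<in> sets (PiM UNIV (\<lambda>_::nat. M))" and n: "N < n" and \<delta>: "\<delta> > 0"
  shows "measure (random_graph M W n) {A. \<exists>\<omega>\<in>K. codegrees_close N n \<delta> \<omega> A}
    \<ge> measure (PiM UNIV (\<lambda>_::nat. M)) K - (real N)\<^sup>2 / (\<delta>\<^sup>2 * real (n - N))"
proof -
  interpret P: product_prob_space "\<lambda>_::nat. M" UNIV by unfold_locales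
  interpret Pn: prob_space "PiM {..<n} (\<lambda>_. M)"
    by (intro prob_space_PiM) unfold_locales
  let ?P = "PiM UNIV (\<lambda>_::nat. M)" and ?Pn = "PiM {..<n} (\<lambda>_. M)"
  let ?B = "{A. \<exists>\<omega>\<in>K. codegrees_close N n \<delta> \<omega> A}"
  let ?I = "{(i, j). i < N \<and> j < N \<and> i \<noteq> j}" and ?t = "\<delta> * real (n - N)"
  let ?r = "\<lambda>\<omega>. restrict \<omega> {..<n}"
  let ?v = "\<lambda>\<omega>. \<Sum>p\<in>?I. codegree_variance N n p \<omega> / ?t\<^sup>2"
  have fin: "finite ?I"
    by (rule finite_subset[of _ "{..<N} \<times> {..<N}"]) auto
  have r: "?r \<in> measurable ?P ?Pn"
    by (intro measurable_restrict_subset) auto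
  \<comment> \<open>The finite sample is the restriction of an infinite one, so the event
    \<open>K\<close> about infinite sequences and the graph on \<open>n\<close> vertices can be
    compared on one probability space.\<close>
  have distr: "distr ?P ?Pn ?r = ?Pn"
    by (intro P.distr_PiM_restrict_finite) auto
  have meas: "(\<lambda>\<omega>. measure (adjacency_pmf W n \<omega>) ?B) \<in> borel_measurable ?Pn"
    by (rule measurable_compose[OF measurable_adjacency_pmf measurable_measure_subprob_algebra]) simp
  have v: "integrable ?Pn ?v"
    using n by (intro Bochner_Integration.integrable_sum Bochner_Integration.integrable_divide) (auto intro: integrable_codegree_variance)
  then have vr: "integrable ?P (\<lambda>\<omega>. ?v (?r \<omega>))"
    using integrable_distr[OF r, of ?v] distr by simp
  have "(LINT \<omega>|?P. ?v (?r \<omega>)) = (LINT \<omega>|?Pn. ?v \<omega>)"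
    using integral_distr[OF r, of ?v] distr v by simp
  also have "\<dots> = (\<Sum>p\<in>?I. (LINT \<omega>|?Pn. codegree_variance N n p \<omega>) / ?t\<^sup>2)"
    using n by (subst Bochner_Integration.integral_sum)
      (auto intro!: Bochner_Integration.integrable_divide integrable_codegree_variance)
  also have "\<dots> = (\<Sum>p\<in>?I. real (n - N) / ?t\<^sup>2)"
    using n by (intro sum.cong) (auto simp: integral_codegree_variance)
  also have "\<dots> = real (card ?I) * (real (n - N) / ?t\<^sup>2)"
    by simp
  also have "\<dots> \<le> (real N)\<^sup>2 * (real (n - N) / ?t\<^sup>2)"
  proof (rule mult_right_mono)
    have "card ?I \<le> card ({..<N} \<times> {..<N})"
      by (intro card_mono) auto
    then show "real (card ?I) \<le> (real N)\<^sup>2"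
      by (simp add: power2_eq_square flip: of_nat_mult)
  qed simp
  also have "\<dots> = (real N)\<^sup>2 / (\<delta>\<^sup>2 * real (n - N))"
  proof -
    have "c * (m / (\<delta> * m)\<^sup>2) = c / (\<delta>\<^sup>2 * m)" if "m > 0" for c m :: real
      using that \<delta> by (simp add: power2_eq_square field_simps)
    then show ?thesis
      using n by simp
  qed
  finally have v_le: "(LINT \<omega>|?P. ?v (?r \<omega>)) \<le> (real N)\<^sup>2 / (\<delta>\<^sup>2 * real (n - N))" .
  \<comment> \<open>The comparison is pointwise in \<open>\<omega>\<close>. On \<open>K\<close> the
    sequence itself witnesses the existential in \<open>?B\<close>, and the Chebyshev bound applies;
    off \<open>K\<close> it suffices that \<open>?v\<close> is nonnegative.\<close>
  have "P.P.prob K - (LINT \<omega>|?P. ?v (?r \<omega>)) = (LINT \<omega>|?P. indicator K \<omega> - ?v (?r \<omega>))"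
    using K vr by (simp add: P.P.emeasure_eq_measure sets.Int_space_eq2)
  also have "\<dots> \<le> (LINT \<omega>|?P. measure (adjacency_pmf W n (?r \<omega>)) ?B)"
  proof (rule integral_mono)
    show "integrable ?P (\<lambda>\<omega>. indicator K \<omega> - ?v (?r \<omega>))"
      using K vr by (intro Bochner_Integration.integrable_diff) (auto simp: P.P.emeasure_eq_measure)
    show "integrable ?P (\<lambda>\<omega>. measure (adjacency_pmf W n (?r \<omega>)) ?B)"
      by (intro P.P.integrable_const_bound[where B = 1] measurable_compose[OF r meas] AE_I2) auto
    fix \<omega> assume "\<omega> \<in> space ?P"
    then have \<omega>: "\<omega> i \<in> space M" for i
      by (auto simp: space_PiM PiE_iff)
    have var: "codegree_variance N n p (?r \<omega>) = codegree_variance N n p \<omega>" if "p \<in> ?I" for p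
      using that n by (auto simp: codegree_variance_def codegree_error_def intro!: sum.cong)
    show "indicator K \<omega> - ?v (?r \<omega>) \<le> measure (adjacency_pmf W n (?r \<omega>)) ?B"
    proof (cases "\<omega> \<in> K")
      case True
      have "indicator K \<omega> - ?v (?r \<omega>) = 1 - ?v \<omega>"
        using True var by simp
      also have "\<dots> \<le> measure (adjacency_pmf W n \<omega>) {A. codegrees_close N n \<delta> \<omega> A}"
        using \<omega> n \<delta> by (intro prob_codegrees_close_ge) auto
      also have "\<dots> \<le> measure (adjacency_pmf W n \<omega>) ?B"
        using True by (intro measure_pmf.finite_measure_mono) auto
      finally show ?thesis
        by (simp add: adjacency_pmf_restrict)
    next
      case False
      \<comment> \<open>The double sum alone may be negative, but together with n - N it dominates
        the expectation of a square.\<close>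
      have "codegree_variance N n p \<omega> \<ge> 0" if "p \<in> ?I" for p
      proof -
        have "0 \<le> measure_pmf.expectation (adjacency_pmf W n \<omega>)
            (\<lambda>A. (\<Sum>k=N..<n. real (A (fst p) k * A (snd p) k) - codegree M W (\<omega> (fst p)) (\<omega> (snd p)))\<^sup>2)"
          by (intro integral_nonneg_AE AE_I2) simp
        also have "\<dots> \<le> codegree_variance N n p \<omega>"
          using expectation_common_neighbours_square_le[of n \<omega> "fst p" "snd p" N] \<omega> n that
          by (auto simp: codegree_variance_def)
        finally show ?thesis .
      qed
      then have "?v (?r \<omega>) \<ge> 0"
        using var by (intro sum_nonneg divide_nonneg_nonneg) auto
      then have "indicator K \<omega> - ?v (?r \<omega>) \<le> 0"
        using False by simp
      also have "0 \<le> measure (adjacency_pmf W n (?r \<omega>)) ?B"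
        by (rule measure_nonneg)
      finally show ?thesis .
    qed
  qed
  also have "\<dots> = (LINT \<omega>|?Pn. measure (adjacency_pmf W n \<omega>) ?B)"
    using integral_distr[OF r meas] distr by simp
  also have "\<dots> = measure (random_graph M W n) ?B"
    unfolding random_graph_def
    using Pn.measure_bind[OF measurable_adjacency_pmf[of n], of ?B] by simp
  finally show ?thesis
    using v_le by simp
qed

lemma prob_space_random_graph: "prob_space (random_graph M W n)"
proof -
  interpret P: prob_space "PiM {..<n} (\<lambda>_. M)"
    by (intro prob_space_PiM) unfold_locales
  show ?thesis
    unfolding random_graph_def
    by (rule P.prob_space_bind[OF _ measurable_adjacency_pmf]) (simp add: measure_pmf.prob_space_axioms)
qed

lemma sets_random_graph: "sets (random_graph M W n) = UNIV"
proof -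
  interpret P: prob_space "PiM {..<n} (\<lambda>_. M)"
    by (intro prob_space_PiM) unfold_locales
  show ?thesis
    unfolding random_graph_def
    using sets_bind[of "PiM {..<n} (\<lambda>_. M)" "\<lambda>\<omega>. measure_pmf (adjacency_pmf W n \<omega>)" "count_space UNIV"] P.not_empty
    by simp
qed

end

section \<open>Matching the two graphons\<close>

text \<open>Two events of probability at least 7/12 under the same law intersect. A graph in both
  has common-neighbour counts within \<delta> (n - N) of the values predicted by
  \<open>\<omega>\<close> and by \<open>\<omega>'\<close>, and the triangle inequality gives 2
  \<delta>.\<close>

lemma approximate_codegrees_eq:
  assumes "graphon M W" "graphon M' W'" "graphon_equiv M W M' W'"
    and K: "K \<in> sets (PiM UNIV (\<lambda>_::nat. M))" "measure (PiM UNIV (\<lambda>_::nat. M)) K \<ge> 2 / 3"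
    and K': "K' \<in> sets (PiM UNIV (\<lambda>_::nat. M'))" "measure (PiM UNIV (\<lambda>_::nat. M')) K' \<ge> 2 / 3"
    and \<delta>: "\<delta> > 0"
  shows "\<exists>\<omega>\<in>K. \<exists>\<omega>'\<in>K'. \<forall>i<N. \<forall>j<N. i \<noteq> j \<longrightarrow>
    \<bar>codegree M W (\<omega> i) (\<omega> j) - codegree M' W' (\<omega>' i) (\<omega>' j)\<bar> \<le> 2 * \<delta>"
proof -
  interpret graphon M W by fact
  interpret graphon': graphon M' W' by fact
  \<comment> \<open>\<open>m\<close> is the number of vertices used for counting. This size brings
    the error N^2 / (\<delta>^2 m) down to 1/12, and 2/3 - 1/12 = 7/12 exceeds 1/2.\<close>
  obtain m :: nat where m: "12 * (real N)\<^sup>2 / \<delta>\<^sup>2 < real m"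
    using reals_Archimedean2 by blast
  have "0 < real m"
    using m by (rule order_le_less_trans[rotated]) simp
  then have m_pos: "0 < m"
    by simp
  define n where "n = N + m"
  have n: "N < n" "n - N = m"
    using m_pos by (auto simp: n_def)
  have small: "(real N)\<^sup>2 / (\<delta>\<^sup>2 * real (n - N)) \<le> 1 / 12"
    using m m_pos \<delta> by (simp add: n(2) field_simps)
  let ?G = "random_graph M W n"
  let ?B = "{A. \<exists>\<omega>\<in>K. codegrees_close N n \<delta> \<omega> A}"
  let ?B' = "{A. \<exists>\<omega>\<in>K'. graphon'.codegrees_close N n \<delta> \<omega> A}"
  have G: "?G = random_graph M' W' n"
    using assms(3) by (simp add: graphon_equiv_def)
  interpret G: prob_space ?G
    by (rule prob_space_random_graph)
  have step: "7 / 12 \<le> b" if "a - q \<le> b" "2 / 3 \<le> a" "q \<le> 1 / 12" for a b q :: real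
    using that by linarith
  have large: "measure ?G ?B \<ge> 7 / 12" "measure ?G ?B' \<ge> 7 / 12"
    using step[OF random_graph_codegrees_close_ge[OF K(1) n(1) \<delta>] K(2) small]
      step[OF graphon'.random_graph_codegrees_close_ge[OF K'(1) n(1) \<delta>] K'(2) small]
    by (simp_all only: G)
  have "?B \<inter> ?B' \<noteq> {}"
  proof
    assume "?B \<inter> ?B' = {}"
    then have "measure ?G (?B \<union> ?B') = measure ?G ?B + measure ?G ?B'"
      by (intro G.finite_measure_Union) (simp_all add: sets_random_graph)
    then show False
      using large G.prob_le_1[of "?B \<union> ?B'"] by linarith
  qed
  then obtain A \<omega> \<omega>' where A: "\<omega> \<in> K" "codegrees_close N n \<delta> \<omega> A"
      "\<omega>' \<in> K'" "graphon'.codegrees_close N n \<delta> \<omega>' A"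
    by blast
  have "\<bar>codegree M W (\<omega> i) (\<omega> j) - codegree M' W' (\<omega>' i) (\<omega>' j)\<bar> \<le> 2 * \<delta>"
    if ij: "i < N" "j < N" "i \<noteq> j" for i j
  proof -
    let ?c = "codegree M W (\<omega> i) (\<omega> j)" and ?c' = "codegree M' W' (\<omega>' i) (\<omega>' j)"
    let ?S = "\<Sum>k=N..<n. real (A i k * A j k)"
    have "\<bar>?S - real m * ?c\<bar> < \<delta> * real m"
      using A(2) ij by (simp add: codegrees_close_def n sum_subtractf)
    moreover have "\<bar>?S - real m * ?c'\<bar> < \<delta> * real m"
      using A(4) ij by (simp add: graphon'.codegrees_close_def n sum_subtractf)
    ultimately have "\<bar>real m * ?c - real m * ?c'\<bar> \<le> \<delta> * real m + \<delta> * real m"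
      by linarith
    moreover have "\<bar>real m * ?c - real m * ?c'\<bar> = real m * \<bar>?c - ?c'\<bar>"
      by (simp add: abs_mult flip: right_diff_distrib)
    ultimately have "real m * \<bar>?c - ?c'\<bar> \<le> real m * (2 * \<delta>)"
      by (simp add: mult.commute mult.left_commute)
    then show ?thesis
      using m_pos by simp
  qed
  with A(1,3) show ?thesis by blast
qed

text \<open>\<open>codegree_diff_le\<close> is applied in one argument and, by symmetry, in the
  other. This makes closeness of codegrees a closed condition in the compactness argument.\<close>

lemma (in pure_graphon) continuous_map_codegree:
  assumes "continuous_map X mtopology f" "continuous_map X mtopology g"
  shows "continuous_map X euclideanreal (\<lambda>x. codegree M W (f x) (g x))"
proof -
  have "continuous_map X Met_TC.mtopology (\<lambda>x. codegree M W (f x) (g x))"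
    unfolding Met_TC.continuous_map_to_metric
  proof (intro ballI allI impI)
    fix x and \<epsilon> :: real assume x: "x \<in> topspace X" and "\<epsilon> > 0"
    then have \<epsilon>: "\<epsilon> / 2 > 0" by simp
    obtain U where U: "openin X U" "x \<in> U" "\<And>y. y \<in> U \<Longrightarrow> f y \<in> mball (f x) (\<epsilon> / 2)"
      using assms(1) x \<epsilon> unfolding continuous_map_to_metric by meson
    obtain V where V: "openin X V" "x \<in> V" "\<And>y. y \<in> V \<Longrightarrow> g y \<in> mball (g x) (\<epsilon> / 2)"
      using assms(2) x \<epsilon> unfolding continuous_map_to_metric by meson
    have "\<bar>codegree M W (f x) (g x) - codegree M W (f y) (g y)\<bar> < \<epsilon>" if "y \<in> U \<inter> V" for y
    proof -
      have f: "f x \<in> space M" "f y \<in> space M" "nbhd_dist M W (f x) (f y) < \<epsilon> / 2"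
        using U(3)[of y] that by auto
      have g: "g x \<in> space M" "g y \<in> space M" "nbhd_dist M W (g x) (g y) < \<epsilon> / 2"
        using V(3)[of y] that by auto
      show ?thesis
        using codegree_diff_le[OF f(1,2) g(1)] codegree_diff_le[OF g(1,2) f(2)] f(3) g(3)
          codegree_commute[of "f y" "g x"] codegree_commute[of "f y" "g y"] by linarith
    qed
    then show "\<exists>U. openin X U \<and> x \<in> U \<and>
        (\<forall>y\<in>U. codegree M W (f y) (g y) \<in> Met_TC.mball (codegree M W (f x) (g x)) \<epsilon>)"
      using U(1,2) V(1,2) by (intro exI[of _ "U \<inter> V"]) (auto simp: dist_real_def)
  qed
  then show ?thesis by simp
qed

text \<open>The sets \<open>C N\<close> of approximately matching pairs are closed, nonempty and
  decreasing in the compact space \<open>K \<times> K'\<close>, so some pair lies in all of them. It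
  is recurrent because all elements of \<open>K\<close> and \<open>K'\<close> are.\<close>

lemma exact_codegrees_eq:
  assumes "pure_graphon M W" "pure_graphon M' W'" "graphon_equiv M W M' W'"
  shows "\<exists>\<omega> \<omega>'. (\<forall>i::nat. \<omega> i \<in> space M) \<and> (\<forall>i::nat. \<omega>' i \<in> space M') \<and>
    (\<forall>i j. i \<noteq> j \<longrightarrow> codegree M W (\<omega> i) (\<omega> j) = codegree M' W' (\<omega>' i) (\<omega>' j)) \<and>
    (\<forall>x\<in>space M. \<forall>\<epsilon>>0. \<forall>s. \<exists>j\<ge>s. nbhd_dist M W x (\<omega> j) < \<epsilon>) \<and>
    (\<forall>x\<in>space M'. \<forall>\<epsilon>>0. \<forall>s. \<exists>j\<ge>s. nbhd_dist M' W' x (\<omega>' j) < \<epsilon>)"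
proof -
  interpret pure_graphon M W by fact
  interpret pure': pure_graphon M' W' by fact
  let ?T = "product_topology (\<lambda>_::nat. mtopology) UNIV"
  let ?T' = "product_topology (\<lambda>_::nat. pure'.mtopology) UNIV"
  obtain K where K: "K \<in> sets (PiM UNIV (\<lambda>_::nat. M))" "compactin ?T K"
      "measure (PiM UNIV (\<lambda>_::nat. M)) K \<ge> 2 / 3"
      "\<And>\<omega> x \<epsilon> s. \<omega> \<in> K \<Longrightarrow> x \<in> space M \<Longrightarrow> \<epsilon> > 0 \<Longrightarrow> \<exists>j\<ge>s. nbhd_dist M W x (\<omega> j) < \<epsilon>"
    using compact_recurrent_set by blast
  obtain K' where K': "K' \<in> sets (PiM UNIV (\<lambda>_::nat. M'))" "compactin ?T' K'"
      "measure (PiM UNIV (\<lambda>_::nat. M')) K' \<ge> 2 / 3"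
      "\<And>\<omega> x \<epsilon> s. \<omega> \<in> K' \<Longrightarrow> x \<in> space M' \<Longrightarrow> \<epsilon> > 0 \<Longrightarrow> \<exists>j\<ge>s. nbhd_dist M' W' x (\<omega> j) < \<epsilon>"
    using pure'.compact_recurrent_set by blast
  have sub: "K \<subseteq> UNIV \<rightarrow>\<^sub>E space M" "K' \<subseteq> UNIV \<rightarrow>\<^sub>E space M'"
    using compactin_subset_topspace[OF K(2)] compactin_subset_topspace[OF K'(2)] by simp_all
  define X where "X = subtopology (prod_topology ?T ?T') (K \<times> K')"
  have top: "topspace X = K \<times> K'"
    using sub unfolding X_def by (auto simp: topspace_subtopology)
  have "compactin (prod_topology ?T ?T') (K \<times> K')"
    using K(2) K'(2) by (simp add: compactin_Times)
  then have compact: "compact_space X"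
    unfolding X_def by (simp add: compact_space_subtopology)
  define F where "F i j p = \<bar>codegree M W (fst p i) (fst p j) - codegree M' W' (snd p i) (snd p j)\<bar>"
    for i j :: nat and p
  have fst_i: "continuous_map X mtopology (\<lambda>p. fst p i)" for i
    unfolding X_def
    using continuous_map_compose[OF continuous_map_fst continuous_map_product_projection[of i UNIV "\<lambda>_. mtopology"]]
    by (intro continuous_map_from_subtopology) (simp add: o_def)
  have snd_i: "continuous_map X pure'.mtopology (\<lambda>p. snd p i)" for i
    unfolding X_def
    using continuous_map_compose[OF continuous_map_snd continuous_map_product_projection[of i UNIV "\<lambda>_. pure'.mtopology"]]
    by (intro continuous_map_from_subtopology) (simp add: o_def)
  have F: "continuous_map X euclideanreal (F i j)" for i j
    unfolding F_def using fst_i snd_i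
    by (intro continuous_map_real_abs continuous_map_diff continuous_map_codegree pure'.continuous_map_codegree)
  \<comment> \<open>\<open>N\<close> sets both the number of vertices compared and the accuracy, so
    the conditions tighten as it grows. The factor 2 comes from
    \<open>approximate_codegrees_eq\<close> with \<delta> = 1 / Suc N.\<close>
  define C where "C N = {p \<in> topspace X. \<forall>i<N. \<forall>j<N. i \<noteq> j \<longrightarrow> F i j p \<le> 2 * (1 / Suc N)}" for N
  have "closedin X (C N)" for N
  proof -
    let ?D = "\<lambda>(i, j). {p \<in> topspace X. F i j p \<in> {..2 * (1 / Suc N)}}"
    \<comment> \<open>Inserting the whole space keeps the family nonempty when N \<le> 1 leaves no
      pair i \<noteq> j.\<close>
    have "C N = \<Inter> (insert (topspace X) (?D ` {(i, j). i < N \<and> j < N \<and> i \<noteq> j}))"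
      by (auto simp: C_def)
    moreover have "closedin X (?D q)" for q
      by (cases q) (simp only: prod.case, rule closedin_continuous_map_preimage[OF F], simp)
    ultimately show ?thesis
      by (simp only:) (rule closedin_Inter, auto)
  qed
  moreover have "C N \<noteq> {}" for N
  proof -
    obtain \<omega> \<omega>' where "\<omega> \<in> K" "\<omega>' \<in> K'" "\<forall>i<N. \<forall>j<N. i \<noteq> j \<longrightarrow>
        \<bar>codegree M W (\<omega> i) (\<omega> j) - codegree M' W' (\<omega>' i) (\<omega>' j)\<bar> \<le> 2 * (1 / Suc N)"
      using approximate_codegrees_eq[OF graphon_axioms pure'.graphon_axioms assms(3) K(1,3) K'(1,3), of "1 / Suc N" N]
      by auto
    then have "(\<omega>, \<omega>') \<in> C N"
      by (simp add: C_def top F_def)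
    then show ?thesis by blast
  qed
  moreover have "decseq C"
  proof (rule decseq_SucI)
    fix N
    have "2 * (1 / Suc (Suc N)) \<le> 2 * (1 / real (Suc N))"
      by (simp add: field_simps)
    then show "C (Suc N) \<subseteq> C N"
      unfolding C_def by (auto intro: order_trans less_SucI)
  qed
  ultimately have "(\<Inter>N. C N) \<noteq> {}"
    by (rule compact_space_imp_nest[OF compact])
  then obtain p where p: "\<And>N. p \<in> C N" by blast
  have "F i j p \<le> 0" if "i \<noteq> j" for i j
  proof (rule LIMSEQ_le_const)
    show "(\<lambda>N. 2 * (1 / real (Suc N))) \<longlonglongrightarrow> 0"
      using tendsto_mult_right_zero[OF LIMSEQ_Suc[OF lim_1_over_n], of 2] by simp
    \<comment> \<open>From N = Suc (max i j) on, the pair (i, j) is among those that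
      \<open>C N\<close> constrains.\<close>
    show "\<exists>N0. \<forall>N\<ge>N0. F i j p \<le> 2 * (1 / real (Suc N))"
      using p that by (intro exI[of _ "Suc (max i j)"]) (auto simp: C_def)
  qed
  then have "codegree M W (fst p i) (fst p j) = codegree M' W' (snd p i) (snd p j)" if "i \<noteq> j" for i j
    using that unfolding F_def by fastforce
  moreover have "fst p \<in> K" "snd p \<in> K'"
    using p[of 0] by (auto simp: C_def top)
  moreover from this have "fst p i \<in> space M" "snd p i \<in> space M'" for i
    using sub by (auto simp: PiE_iff)
  ultimately show ?thesis
    using K(4)[of "fst p"] K'(4)[of "snd p"] by (intro exI[of _ "fst p"] exI[of _ "snd p"] conjI) simp_all
qed

lemma covering_number_le_of_equiv:
  assumes "pure_graphon M W" "pure_graphon M' W'" "graphon_equiv M W M' W'"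
  shows "covering_number M' W' \<epsilon> \<le> covering_number M W \<epsilon>"
proof -
  interpret pure_graphon M W by fact
  interpret pure': pure_graphon M' W' by fact
  from exact_codegrees_eq[OF assms] obtain \<omega> \<omega>' where seqs:
    "\<forall>i::nat. \<omega> i \<in> space M" "\<forall>i::nat. \<omega>' i \<in> space M'"
    "\<forall>i j. i \<noteq> j \<longrightarrow> codegree M W (\<omega> i) (\<omega> j) = codegree M' W' (\<omega>' i) (\<omega>' j)"
    "\<forall>x\<in>space M. \<forall>\<epsilon>>0. \<forall>s. \<exists>j\<ge>s. nbhd_dist M W x (\<omega> j) < \<epsilon>"
    "\<forall>x\<in>space M'. \<forall>\<epsilon>>0. \<forall>s. \<exists>j\<ge>s. nbhd_dist M' W' x (\<omega>' j) < \<epsilon>"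
    by (elim exE conjE)
  note \<omega> = seqs(1)[rule_format] and \<omega>' = seqs(2)[rule_format] and off = seqs(3)[rule_format]
    and dense = seqs(4)[rule_format] and dense' = seqs(5)[rule_format]
  have "codegree M W (\<omega> i) (\<omega> i) = codegree M' W' (\<omega>' i) (\<omega>' i)" for i
    using graphon_axioms pure'.graphon_axioms \<omega> \<omega>' off dense[OF \<omega>] dense'[OF \<omega>']
    by (rule codegree_diagonal_eq)
  then have "codegree M W (\<omega> i) (\<omega> j) = codegree M' W' (\<omega>' i) (\<omega>' j)" for i j
    using off by (cases "i = j") auto
  \<comment> \<open>With the diagonal matched as well, \<open>nbhd_dist_codegree\<close> expresses
    both distances through the same numbers.\<close>
  then have iso: "nbhd_dist M' W' (\<omega>' i) (\<omega>' j) = nbhd_dist M W (\<omega> i) (\<omega> j)" for i j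
    using \<omega> \<omega>' by (simp add: nbhd_dist_codegree pure'.nbhd_dist_codegree)
  show ?thesis
  proof (rule covering_number_le)
    fix C assume C: "finite C" "C \<subseteq> space M"
      "space M \<subseteq> (\<Union>c\<in>C. Metric_space.mcball (space M) (nbhd_dist M W) c \<epsilon>)"
    show "\<exists>C'. finite C' \<and> card C' \<le> card C \<and> C' \<subseteq> space M' \<and>
        space M' \<subseteq> (\<Union>c\<in>C'. Metric_space.mcball (space M') (nbhd_dist M' W') c \<epsilon>)"
    proof (rule Metric_space_transfer_cover[OF Metric_space_axioms complete
          pure'.Metric_space_axioms pure'.complete \<omega> \<omega>' iso _ _ C])
      show "\<exists>i. nbhd_dist M W x (\<omega> i) < \<delta>" if "x \<in> space M" "\<delta> > 0" for x \<delta>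
        using dense[OF that] by blast
      show "\<exists>i. nbhd_dist M' W' x (\<omega>' i) < \<delta>" if "x \<in> space M'" "\<delta> > 0" for x \<delta>
        using dense'[OF that] by blast
    qed
  qed
qed

theorem lemma3:
  fixes M :: "'a measure" and W :: "'a \<Rightarrow> 'a \<Rightarrow> real"
    and M' :: "'b measure" and W' :: "'b \<Rightarrow> 'b \<Rightarrow> real"
  assumes "pure_graphon M W" and "pure_graphon M' W'"
    and "graphon_equiv M W M' W'"
  shows "\<forall>\<epsilon>>0. covering_number M W \<epsilon> = covering_number M' W' \<epsilon>"
proof -
  have "graphon_equiv M' W' M W"
    using assms(3) by (simp add: graphon_equiv_def)
  then show ?thesis
    using assms by (intro allI impI order_antisym covering_number_le_of_equiv)
qed

end
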